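(* There exists an oracle $A \subseteq \{0,1\}^*$ such that $\mathrm{UP}^A \cap \mathrm{coUP}^A \not\subseteq \mathrm{QSZK}^A$.
   Context: An oracle is a set $A \subseteq \{0,1\}^*$ of binary strings to which membership queries are available at unit cost. $\mathrm{UP}^A$ is the class of languages $L$ for which there is a polynomial-time nondeterministic oracle Turing machine $M$ with oracle $A$ such that $M$ has exactly one accepting computation path on every input $x \in L$ and no accepting computation path on every input $x \notin L$; $\mathrm{coUP}^A$ is the class of complements of languages in $\mathrm{UP}^A$. $\mathrm{QSZK}^A$ is the class of languages having honest-verifier quantum statistical zero-knowledge interactive proof systems relative to $A$: a polynomial-time uniform family of quantum verifier circuits (which may contain query gates to $A$, where a query gate for $n$-bit strings acts as $|x\rangle|a\rangle \mapsto |x\rangle|a \oplus [x\in A]\rangle$) interacting with a prover (which may also query $A$), such that on inputs in $L$ some prover makes the verifier accept with high probability, on inputs not in $L$ every prover makes it accept with only small probability, and on inputs in $L$ the view of the (unitarily purified) verifier has negligible trace distance to a state produced by a polynomial-time uniform family of relativized quantum circuits that do not interact with a prover. (Equivalently, $L \in \mathrm{QSZK}^A$ iff there is a polynomial-time uniform family of pairs of relativized quantum circuits $(Q_0^x, Q_1^x)$, taking no input and producing states $\rho_0^x(A),\rho_1^x(A)$ on the same number of qubits when queries are answered according to $A$, with $\frac12\|\rho_0^x(A)-\rho_1^x(A)\|_1 \ge 2/3$ for $x\in L$ and $\le 1/3$ for $x \notin L$.) *)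

theory Defs
  imports
    "HOL-Analysis.Analysis"
    "HOL-Computational_Algebra.Polynomial"
    "Jordan_Normal_Form.Schur_Decomposition"
begin

section \<open>Nondeterministic oracle Turing machines\<close>

text \<open>
  A machine has one read-write work tape, which initially holds the input and on halting
  holds the output, and one read-write oracle tape. Both are infinite in both directions.
  The transition relation is a finite list of tuples, so only finitely many states and tape
  symbols occur in a machine.
\<close>

datatype sym = Blank | Bit bool | Aux nat

datatype dir = Lt | St | Rt

type_synonym tape = "int \<Rightarrow> sym"

text \<open>
  A transition \<open>(q, a, b, q', a', b', d, e)\<close>: in state \<open>q\<close>, reading \<open>a\<close> on the work tape and
  \<open>b\<close> on the oracle tape, go to state \<open>q'\<close>, write \<open>a'\<close> and \<open>b'\<close>, and move the two heads in
  directions \<open>d\<close> and \<open>e\<close>.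
\<close>

type_synonym transition = "nat \<times> sym \<times> sym \<times> nat \<times> sym \<times> sym \<times> dir \<times> dir"

datatype otm = OTM
  (start_state: nat) (accept_state: nat)
  (query_state: nat) (yes_state: nat) (no_state: nat)
  (transitions: "transition list")

record config =
  state :: nat
  work :: tape
  work_pos :: int
  otape :: tape
  otape_pos :: int

primrec shift :: "dir \<Rightarrow> int" where
  "shift Lt = -1"
| "shift St = 0"
| "shift Rt = 1"

text \<open>The bit string on a tape begins at cell 0 and ends before the first cell without a bit.\<close>

definition tape_string :: "tape \<Rightarrow> bool list" where
  "tape_string T =
     map (\<lambda>i. T (int i) = Bit True) [0..<(LEAST i::nat. \<forall>b. T (int i) \<noteq> Bit b)]"

definition string_tape :: "bool list \<Rightarrow> tape" where
  "string_tape x = (\<lambda>i. if 0 \<le> i \<and> nat i < length x then Bit (x ! nat i) else Blank)"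

definition initial_config :: "otm \<Rightarrow> bool list \<Rightarrow> config" where
  "initial_config M x =
     \<lparr>state = start_state M, work = string_tape x, work_pos = 0,
      otape = (\<lambda>_. Blank), otape_pos = 0\<rparr>"

text \<open>A query is one step: it branches on the answer and erases the oracle tape.\<close>

definition oracle_step :: "otm \<Rightarrow> bool list set \<Rightarrow> config \<Rightarrow> config" where
  "oracle_step M A c =
     c\<lparr>state := (if tape_string (otape c) \<in> A then yes_state M else no_state M),
       otape := (\<lambda>_. Blank), otape_pos := 0\<rparr>"

definition tm_step :: "otm \<Rightarrow> bool list set \<Rightarrow> config \<Rightarrow> config \<Rightarrow> bool" where
  "tm_step M A c c' \<longleftrightarrow>
     (if state c = query_state M then c' = oracle_step M A c
      else \<exists>q' a' b' d e.
        (state c, work c (work_pos c), otape c (otape_pos c), q', a', b', d, e)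
          \<in> set (transitions M) \<and>
        c' = \<lparr>state = q',
              work = (work c)(work_pos c := a'), work_pos = work_pos c + shift d,
              otape = (otape c)(otape_pos c := b'), otape_pos = otape_pos c + shift e\<rparr>)"

definition halted :: "otm \<Rightarrow> bool list set \<Rightarrow> config \<Rightarrow> bool" where
  "halted M A c \<longleftrightarrow> (\<nexists>c'. tm_step M A c c')"

text \<open>
  Distinct transitions applicable to a configuration lead to distinct configurations, so
  computation paths may be identified with sequences of configurations.
\<close>

definition accepting_path :: "otm \<Rightarrow> bool list set \<Rightarrow> bool list \<Rightarrow> config list \<Rightarrow> bool" where
  "accepting_path M A x cs \<longleftrightarrow>
     cs \<noteq> [] \<and> hd cs = initial_config M x \<and> successively (tm_step M A) cs \<and>
     halted M A (last cs) \<and> state (last cs) = accept_state M"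

definition poly_time :: "otm \<Rightarrow> bool list set \<Rightarrow> bool" where
  "poly_time M A \<longleftrightarrow>
     (\<exists>p :: nat poly. \<forall>x t c.
        (tm_step M A ^^ t) (initial_config M x) c \<longrightarrow> t \<le> poly p (length x))"

definition deterministic :: "otm \<Rightarrow> bool" where
  "deterministic M \<longleftrightarrow>
     (\<forall>q a b r r'. (q, a, b, r) \<in> set (transitions M) \<and> (q, a, b, r') \<in> set (transitions M)
        \<longrightarrow> r = r')"

text \<open>Ordinary (oracle-free) computation is computation with the empty oracle.\<close>

definition poly_time_computable :: "(bool list \<Rightarrow> bool list) \<Rightarrow> bool" where
  "poly_time_computable f \<longleftrightarrow>
     (\<exists>M. deterministic M \<and> poly_time M {} \<and>
        (\<forall>x c. (tm_step M {})\<^sup>*\<^sup>* (initial_config M x) c \<and> halted M {} c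
           \<longrightarrow> tape_string (work c) = f x))"


section \<open>The classes UP and coUP relative to an oracle\<close>

definition UP :: "bool list set \<Rightarrow> bool list set set" where
  "UP A = {L. \<exists>M. poly_time M A \<and>
     (\<forall>x. (x \<in> L \<longrightarrow> (\<exists>!cs. accepting_path M A x cs)) \<and>
          (x \<notin> L \<longrightarrow> (\<nexists>cs. accepting_path M A x cs)))}"

definition coUP :: "bool list set \<Rightarrow> bool list set set" where
  "coUP A = {L. - L \<in> UP A}"


section \<open>Relativized quantum circuits\<close>

text \<open>
  A pure state of \<open>n\<close> qubits is given by its amplitudes on the bit strings of length \<open>n\<close>;
  values on other lists are irrelevant.
\<close>

type_synonym qstate = "bool list \<Rightarrow> complex"

abbreviation bits :: "nat \<Rightarrow> bool list set" where
  "bits n \<equiv> {x. length x = n}"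

text \<open>
  Hadamard, the phase gate diag(1, i), Toffoli (controls first) and query gates. The gate
  \<open>Query qs t\<close> adds to qubit \<open>t\<close> the membership bit of the string held by the qubits \<open>qs\<close>.
\<close>

datatype gate = Had nat | Phase nat | Toffoli nat nat nat | Query "nat list" nat

primrec gate_qubits :: "gate \<Rightarrow> nat list" where
  "gate_qubits (Had i) = [i]"
| "gate_qubits (Phase i) = [i]"
| "gate_qubits (Toffoli i j k) = [i, j, k]"
| "gate_qubits (Query qs t) = qs @ [t]"

type_synonym circuit = "gate list"

definition wf_circuit :: "nat \<Rightarrow> circuit \<Rightarrow> bool" where
  "wf_circuit n C \<longleftrightarrow> (\<forall>g\<in>set C. distinct (gate_qubits g) \<and> set (gate_qubits g) \<subseteq> {..<n})"

text \<open>
  The Toffoli and query gates permute the basis states by an involution, so the new amplitude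
  of \<open>x\<close> is the old amplitude of the image of \<open>x\<close>.
\<close>

primrec apply_gate :: "bool list set \<Rightarrow> gate \<Rightarrow> qstate \<Rightarrow> qstate" where
  "apply_gate A (Had i) \<psi> =
     (\<lambda>x. (\<psi> (x[i := False]) + (if x ! i then -1 else 1) * \<psi> (x[i := True]))
            / complex_of_real (sqrt 2))"
| "apply_gate A (Phase i) \<psi> = (\<lambda>x. (if x ! i then \<i> else 1) * \<psi> x)"
| "apply_gate A (Toffoli i j k) \<psi> = (\<lambda>x. \<psi> (x[k := (x ! k \<noteq> (x ! i \<and> x ! j))]))"
| "apply_gate A (Query qs t) \<psi> = (\<lambda>x. \<psi> (x[t := (x ! t \<noteq> (map ((!) x) qs \<in> A))]))"

definition apply_circuit :: "bool list set \<Rightarrow> circuit \<Rightarrow> qstate \<Rightarrow> qstate" where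
  "apply_circuit A C = fold (apply_gate A) C"

definition zero_state :: "nat \<Rightarrow> qstate" where
  "zero_state n = (\<lambda>x. if x = replicate n False then 1 else 0)"

text \<open>
  The reduced density operator of the first \<open>k\<close> qubits of an \<open>n\<close>-qubit pure state, with respect
  to an enumeration of the bit strings of length \<open>k\<close>.
\<close>

definition basis :: "nat \<Rightarrow> nat \<Rightarrow> bool list" where
  "basis k i = List.n_lists k [False, True] ! i"

definition reduced_state :: "nat \<Rightarrow> nat \<Rightarrow> qstate \<Rightarrow> complex mat" where
  "reduced_state k n \<psi> =
     mat (2 ^ k) (2 ^ k)
       (\<lambda>(i, j). \<Sum>z\<in>bits (n - k). \<psi> (basis k i @ z) * cnj (\<psi> (basis k j @ z)))"

text \<open>
  The trace norm \<open>Tr (sqrt (X\<^sup>* X))\<close>, i.e. the sum of the singular values of \<open>X\<close>: the square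
  roots of the eigenvalues of \<open>X\<^sup>* X\<close>, counted with algebraic multiplicity.
\<close>

definition trace_norm :: "complex mat \<Rightarrow> real" where
  "trace_norm X =
     (let p = char_poly (mat_adjoint X * X)
      in \<Sum>a | poly p a = 0. real (Polynomial.order a p) * sqrt (Re a))"

definition trace_distance :: "complex mat \<Rightarrow> complex mat \<Rightarrow> real" where
  "trace_distance \<rho> \<sigma> = trace_norm (\<rho> - \<sigma>) / 2"


section \<open>Quantum interactive proof systems\<close>

text \<open>
  A verifier for a fixed input has private qubits, message qubits, and a list of circuits
  \<open>V\<^sub>0, \<dots>, V\<^sub>r\<close> acting on both. The prover applies unitary operators \<open>P\<^sub>0, P\<^sub>1, \<dots>\<close> to the message
  qubits and \<open>p\<close> private qubits of its own. All qubits start in state 0, the operations are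
  \<open>V\<^sub>0, P\<^sub>0, V\<^sub>1, P\<^sub>1, \<dots>, P\<^bsub>r-1\<^esub>, V\<^sub>r\<close>, and the verifier then measures its first private qubit.
  The qubits are ordered: verifier-private, message, prover-private.
\<close>

datatype verifier = Verifier (priv: nat) (msg: nat) (circuits: "circuit list")

definition wf_verifier :: "verifier \<Rightarrow> bool" where
  "wf_verifier V \<longleftrightarrow> priv V \<ge> 1 \<and> circuits V \<noteq> [] \<and>
     (\<forall>C\<in>set (circuits V). wf_circuit (priv V + msg V) C)"

text \<open>Operators on qubits are given by their matrix entries \<open>U x y\<close> (row \<open>x\<close>, column \<open>y\<close>).\<close>

type_synonym qop = "bool list \<Rightarrow> bool list \<Rightarrow> complex"

definition unitary_op :: "nat \<Rightarrow> qop \<Rightarrow> bool" where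
  "unitary_op n U \<longleftrightarrow>
     (\<forall>x\<in>bits n. \<forall>y\<in>bits n. (\<Sum>z\<in>bits n. cnj (U z x) * U z y) = (if x = y then 1 else 0))"

definition is_prover :: "verifier \<Rightarrow> nat \<Rightarrow> (nat \<Rightarrow> qop) \<Rightarrow> bool" where
  "is_prover V p P \<longleftrightarrow> (\<forall>i. unitary_op (msg V + p) (P i))"

text \<open>The operator \<open>U\<close> applied to the last \<open>n\<close> qubits, the first \<open>v\<close> qubits being left alone.\<close>

definition apply_last :: "nat \<Rightarrow> nat \<Rightarrow> qop \<Rightarrow> qstate \<Rightarrow> qstate" where
  "apply_last v n U \<psi> = (\<lambda>x. \<Sum>y\<in>bits n. U (drop v x) y * \<psi> (take v x @ y))"

text \<open>
  The joint state after the first \<open>j\<close> of the operations \<open>V\<^sub>0, P\<^sub>0, V\<^sub>1, P\<^sub>1, \<dots>\<close>. For \<open>j \<le> 2 r\<close>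
  this is the state after \<open>j\<close> messages; the final operation \<open>V\<^sub>r\<close> sends no message.
\<close>

primrec joint_state ::
  "bool list set \<Rightarrow> verifier \<Rightarrow> nat \<Rightarrow> (nat \<Rightarrow> qop) \<Rightarrow> nat \<Rightarrow> qstate" where
  "joint_state A V p P 0 = zero_state (priv V + msg V + p)"
| "joint_state A V p P (Suc j) =
     (if even j then apply_circuit A (circuits V ! (j div 2)) (joint_state A V p P j)
      else apply_last (priv V) (msg V + p) (P (j div 2)) (joint_state A V p P j))"

definition num_messages :: "verifier \<Rightarrow> nat" where
  "num_messages V = 2 * (length (circuits V) - 1)"

definition accept_prob :: "bool list set \<Rightarrow> verifier \<Rightarrow> nat \<Rightarrow> (nat \<Rightarrow> qop) \<Rightarrow> real" where
  "accept_prob A V p P =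
     (\<Sum>x | x \<in> bits (priv V + msg V + p) \<and> x ! 0.
        (cmod (joint_state A V p P (Suc (num_messages V)) x))\<^sup>2)"

text \<open>The verifier's view after \<open>j\<close> messages: the state of its private and the message qubits.\<close>

definition view ::
  "bool list set \<Rightarrow> verifier \<Rightarrow> nat \<Rightarrow> (nat \<Rightarrow> qop) \<Rightarrow> nat \<Rightarrow> complex mat" where
  "view A V p P j =
     reduced_state (priv V + msg V) (priv V + msg V + p) (joint_state A V p P j)"

text \<open>
  A simulator for a fixed input is a list of circuits with their numbers of qubits. Its
  \<open>j\<close>-th circuit, run on the all-zero state, outputs on its first qubits a state intended to
  approximate the view after \<open>j\<close> messages; the remaining qubits are traced out.
\<close>

type_synonym simulator = "(nat \<times> circuit) list"

definition wf_simulator :: "verifier \<Rightarrow> simulator \<Rightarrow> bool" where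
  "wf_simulator V S \<longleftrightarrow> length S = num_messages V + 1 \<and>
     (\<forall>(s, C)\<in>set S. priv V + msg V \<le> s \<and> wf_circuit s C)"

definition simulated_view :: "bool list set \<Rightarrow> verifier \<Rightarrow> nat \<times> circuit \<Rightarrow> complex mat" where
  "simulated_view A V = (\<lambda>(s, C).
     reduced_state (priv V + msg V) s (apply_circuit A C (zero_state s)))"


section \<open>Uniformity\<close>

text \<open>
  Circuit descriptions as bit strings, by a prefix code. Numbers are written in unary, so
  polynomial-time uniformity also bounds the numbers of qubits polynomially.
\<close>

definition enc_nat :: "nat \<Rightarrow> bool list" where
  "enc_nat n = replicate n True @ [False]"

definition enc_list :: "('a \<Rightarrow> bool list) \<Rightarrow> 'a list \<Rightarrow> bool list" where
  "enc_list e xs = concat (map (\<lambda>x. True # e x) xs) @ [False]"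

primrec enc_gate :: "gate \<Rightarrow> bool list" where
  "enc_gate (Had i) = [False, False] @ enc_nat i"
| "enc_gate (Phase i) = [False, True] @ enc_nat i"
| "enc_gate (Toffoli i j k) = [True, False] @ enc_nat i @ enc_nat j @ enc_nat k"
| "enc_gate (Query qs t) = [True, True] @ enc_list enc_nat qs @ enc_nat t"

definition enc_verifier :: "verifier \<Rightarrow> bool list" where
  "enc_verifier V =
     enc_nat (priv V) @ enc_nat (msg V) @ enc_list (enc_list enc_gate) (circuits V)"

definition enc_simulator :: "simulator \<Rightarrow> bool list" where
  "enc_simulator S = enc_list (\<lambda>(s, C). enc_nat s @ enc_list enc_gate C) S"


section \<open>The class QSZK relative to an oracle\<close>

definition negligible_fun :: "(nat \<Rightarrow> real) \<Rightarrow> bool" where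
  "negligible_fun \<epsilon> \<longleftrightarrow> (\<forall>c::nat. \<forall>\<^sub>F n in sequentially. \<bar>\<epsilon> n\<bar> < 1 / real n ^ c)"

text \<open>
  Honest-verifier quantum statistical zero-knowledge, with acceptance thresholds 2/3 and 1/3.
  The same prover must witness completeness and have its interaction simulated.
\<close>

definition QSZK :: "bool list set \<Rightarrow> bool list set set" where
  "QSZK A = {L. \<exists>(V :: bool list \<Rightarrow> verifier) (S :: bool list \<Rightarrow> simulator) \<epsilon>.
     poly_time_computable (\<lambda>x. enc_verifier (V x)) \<and>
     poly_time_computable (\<lambda>x. enc_simulator (S x)) \<and>
     negligible_fun \<epsilon> \<and>
     (\<forall>x. wf_verifier (V x) \<and> wf_simulator (V x) (S x)) \<and>
     (\<forall>x\<in>L. \<exists>p P. is_prover (V x) p P \<and>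
        accept_prob A (V x) p P \<ge> 2 / 3 \<and>
        (\<forall>j\<le>num_messages (V x).
           trace_distance (simulated_view A (V x) (S x ! j)) (view A (V x) p P j)
             \<le> \<epsilon> (length x))) \<and>
     (\<forall>x. x \<notin> L \<longrightarrow>
        (\<forall>p P. is_prover (V x) p P \<longrightarrow> accept_prob A (V x) p P \<le> 1 / 3))}"

end

theory Submission
  imports Defs
begin

unbundle no vec_syntax and no inner_syntax

text \<open>
  The oracle contains exactly one string of every positive length, and the language asks for the
  first bit of the string of length one more than the input. Guessing the string puts the
  language in UP and in coUP.

  Suppose a verifier with a simulator works for this language. If the marked string \<open>w\<close> begins
  with 1, the views of the honest interaction are close to the outputs of the simulator, and these
  hardly depend on \<open>w\<close>, since few queries cannot find a random string. Hence the verifier, in its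
  interaction with the honest prover for \<open>w\<close>, puts little weight on queries to \<open>w\<close> or to a typical
  \<open>w'\<close> beginning with 0. So the same prover convinces the verifier with almost the same
  probability when the oracle marks \<open>w'\<close> instead of \<open>w\<close>, contradicting soundness. A category
  argument over the countably many uniform pairs of verifiers and simulators yields a single oracle.
\<close>

subsection \<open>A language in UP and coUP\<close>

text \<open>The obstacle is the prover: its unitaries may depend on \<open>w\<close> in any way, so
  counting gates says nothing about the interaction as such. The simulator makes counting possible.
  Its circuits, and the verifier's circuits run on simulated views, form prover-free runs. Under an
  oracle \<open>B\<close> with no string marked at the critical length, the query weights in these
  runs sum to at most the number of gates, and \<open>w\<close> and \<open>w'\<close> are picked
  light there, before any prover enters. The weight of a verifier query is a quadratic form of norm
  at most 1 in the state of the private and message qubits; so the prover's own qubits do not enter,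
  and a trace distance of \<epsilon> costs at most 2 * \<epsilon>. The oracle for \<open>w'\<close>
  is reached from the one for \<open>w\<close> through \<open>B\<close>, which differs from each in
  a single string. The square root of the accumulated error is multiplied by the number of gates,
  which is why \<epsilon> must lie below an inverse polynomial that depends on the system.\<close>

lemma string_tape_Nil: "string_tape [] = (\<lambda>_. Blank)"
  by (auto simp: string_tape_def)

lemma string_tape_snoc:
  "(string_tape ys)(int (length ys) := Bit d) = string_tape (ys @ [d])"
  by (rule ext) (auto simp: string_tape_def nth_append nat_less_iff)

lemma tape_string_string_tape: "tape_string (string_tape ys) = ys"
proof -
  have "(LEAST i::nat. \<forall>b. string_tape ys (int i) \<noteq> Bit b) = length ys"
  proof (rule Least_equality)
    show "\<forall>b. string_tape ys (int (length ys)) \<noteq> Bit b" by (simp add: string_tape_def)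
    show "length ys \<le> y" if "\<forall>b. string_tape ys (int y) \<noteq> Bit b" for y
      using that by (cases "y < length ys") (auto simp: string_tape_def)
  qed
  thus ?thesis
    by (auto simp: tape_string_def string_tape_def intro!: nth_equalityI)
qed

text \<open>
  State 0 writes \<open>b\<close> on the oracle tape, state 1 appends one guessed bit per input symbol, state 2
  queries, state 3 accepts and state 4 rejects.
\<close>

definition guess_machine :: "bool \<Rightarrow> otm" where
  "guess_machine b = OTM 0 3 2 3 4
     [(0, Blank, Blank, 1, Blank, Bit b, St, Rt),
      (0, Bit False, Blank, 1, Bit False, Bit b, St, Rt),
      (0, Bit True, Blank, 1, Bit True, Bit b, St, Rt),
      (1, Bit False, Blank, 1, Bit False, Bit False, Rt, Rt),
      (1, Bit False, Blank, 1, Bit False, Bit True, Rt, Rt),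
      (1, Bit True, Blank, 1, Bit True, Bit False, Rt, Rt),
      (1, Bit True, Blank, 1, Bit True, Bit True, Rt, Rt),
      (1, Blank, Blank, 2, Blank, Blank, St, St)]"

definition guess_config :: "nat \<Rightarrow> bool list \<Rightarrow> nat \<Rightarrow> bool list \<Rightarrow> config" where
  "guess_config q x i ys = \<lparr>state = q, work = string_tape x, work_pos = int i,
     otape = string_tape ys, otape_pos = int (length ys)\<rparr>"

lemma initial_config_guess: "initial_config (guess_machine b) x = guess_config 0 x 0 []"
  by (simp add: initial_config_def guess_config_def guess_machine_def string_tape_Nil)

lemma string_tape_end: "string_tape ys (int (length ys)) = Blank"
  by (simp add: string_tape_def)

lemma string_tape_nth: "i < length x \<Longrightarrow> string_tape x (int i) = Bit (x ! i)"
  by (simp add: string_tape_def)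

lemma guess_step_start:
  "tm_step (guess_machine b) A (guess_config 0 x 0 []) c' \<longleftrightarrow> c' = guess_config (Suc 0) x 0 [b]"
proof -
  have "string_tape x 0 = Blank \<or> string_tape x 0 = Bit True \<or> string_tape x 0 = Bit False"
    by (auto simp: string_tape_def)
  moreover have "(string_tape [])(0 := Bit b) = string_tape [b]"
    using string_tape_snoc[of "[]" b] by simp
  moreover have "string_tape [] 0 = Blank" by (simp add: string_tape_def)
  ultimately show ?thesis
    by (auto simp: tm_step_def guess_machine_def guess_config_def fun_upd_idem)
qed

lemma guess_step_bit:
  assumes "i < length x"
  shows "tm_step (guess_machine b) A (guess_config (Suc 0) x i ys) c' \<longleftrightarrow>
    (\<exists>d. c' = guess_config (Suc 0) x (Suc i) (ys @ [d]))"
proof -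
  have x: "string_tape x (int i) = Bit (x ! i)" using assms by (rule string_tape_nth)
  have "(string_tape x)(int i := Bit (x ! i)) = string_tape x" using x by auto
  moreover have "int i + 1 = int (Suc i)" "int (length ys) + 1 = int (length (ys @ [d]))" for d
    by auto
  ultimately show ?thesis using x string_tape_end[of ys] string_tape_snoc[of ys]
    by (cases "x ! i") (simp_all add: tm_step_def guess_machine_def guess_config_def ex_bool_eq
        conj_disj_distribR ex_disj_distrib disj_commute add.commute)
qed

lemma guess_step_end:
  "tm_step (guess_machine b) A (guess_config (Suc 0) x (length x) ys) c' \<longleftrightarrow>
    c' = guess_config 2 x (length x) ys"
proof -
  have "(string_tape z)(int (length z) := Blank) = string_tape z" for z
    using string_tape_end[of z] by auto
  thus ?thesis using string_tape_end[of ys] string_tape_end[of x]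
    by (auto simp: tm_step_def guess_machine_def guess_config_def)
qed

lemma guess_step_query:
  "tm_step (guess_machine b) A (guess_config 2 x i ys) c' \<longleftrightarrow>
    c' = guess_config (if ys \<in> A then 3 else 4) x i []"
  by (auto simp: tm_step_def oracle_step_def guess_machine_def guess_config_def
      tape_string_string_tape string_tape_Nil)

lemma guess_halted:
  "q = 3 \<or> q = 4 \<Longrightarrow> \<not> tm_step (guess_machine b) A (guess_config q x i ys) c'"
  by (auto simp: tm_step_def guess_machine_def guess_config_def)

text \<open>After the remaining guesses come only the move to state 2 and the query; both answer
  states halt.\<close>

lemma guess_time:
  assumes "i \<le> length x" "(tm_step (guess_machine b) A ^^ t) (guess_config (Suc 0) x i ys) c"
  shows "t \<le> length x - i + 2"
  using assms
proof (induction "length x - i" arbitrary: i ys t)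
  case 0
  hence i: "i = length x" by simp
  show ?case
  proof (cases t)
    case (Suc t1)
    then obtain c1 where "tm_step (guess_machine b) A (guess_config (Suc 0) x i ys) c1"
      "(tm_step (guess_machine b) A ^^ t1) c1 c"
      using 0 by (meson relpowp_Suc_D2)
    hence c1: "(tm_step (guess_machine b) A ^^ t1) (guess_config 2 x i ys) c"
      using i guess_step_end by simp
    show ?thesis
    proof (cases t1)
      case (Suc t2)
      then obtain c2 where "tm_step (guess_machine b) A (guess_config 2 x i ys) c2"
        "(tm_step (guess_machine b) A ^^ t2) c2 c"
        using c1 by (meson relpowp_Suc_D2)
      hence c2: "(tm_step (guess_machine b) A ^^ t2) (guess_config (if ys \<in> A then 3 else 4) x i []) c"
        using guess_step_query by simp
      have "t2 = 0"
      proof (rule ccontr)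
        assume "t2 \<noteq> 0"
        then obtain t3 where "t2 = Suc t3" using not0_implies_Suc by blast
        with c2 obtain c3 where
          "tm_step (guess_machine b) A (guess_config (if ys \<in> A then 3 else 4) x i []) c3"
          by (meson relpowp_Suc_D2)
        thus False using guess_halted by (auto split: if_splits)
      qed
      thus ?thesis using Suc \<open>t = Suc t1\<close> by simp
    qed (use Suc in simp)
  qed simp
next
  case (Suc k)
  hence i: "i < length x" by simp
  show ?case
  proof (cases t)
    case (Suc t1)
    then obtain c1 where "tm_step (guess_machine b) A (guess_config (Suc 0) x i ys) c1"
      and c1: "(tm_step (guess_machine b) A ^^ t1) c1 c"
      using Suc.prems by (meson relpowp_Suc_D2)
    then obtain d where "c1 = guess_config (Suc 0) x (Suc i) (ys @ [d])"
      using guess_step_bit[OF i] by blast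
    hence "t1 \<le> length x - Suc i + 2"
      using Suc.hyps(1)[of "Suc i" t1 "ys @ [d]"] Suc.hyps(2) i c1 by simp
    thus ?thesis using Suc i by simp
  qed simp
qed

lemma poly_time_guess_machine: "poly_time (guess_machine b) A"
  unfolding poly_time_def
\<comment> \<open>The polynomial n + 3: the step that writes \<open>b\<close>, one step per input
  symbol, and the last two steps.\<close>
proof (intro exI[of _ "[:3, 1:]"] allI impI)
  fix x t c
  assume t: "(tm_step (guess_machine b) A ^^ t) (initial_config (guess_machine b) x) c"
  show "t \<le> poly [:3, 1:] (length x)"
  proof (cases t)
    case (Suc t1)
    then obtain c1 where "tm_step (guess_machine b) A (guess_config 0 x 0 []) c1"
      "(tm_step (guess_machine b) A ^^ t1) c1 c"
      using t unfolding initial_config_guess by (meson relpowp_Suc_D2)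
    hence "(tm_step (guess_machine b) A ^^ t1) (guess_config (Suc 0) x 0 [b]) c"
      using guess_step_start by simp
    from guess_time[OF _ this] show ?thesis using Suc by simp
  qed simp
qed

text \<open>An arbitrary starting configuration allows recursion on the first step of a
  path.\<close>

definition accepting_from :: "otm \<Rightarrow> bool list set \<Rightarrow> config \<Rightarrow> config list \<Rightarrow> bool" where
  "accepting_from M A c cs \<longleftrightarrow> cs \<noteq> [] \<and> hd cs = c \<and> successively (tm_step M A) cs \<and>
     halted M A (last cs) \<and> state (last cs) = accept_state M"

lemma accepting_from_unfold:
  "accepting_from M A c cs \<longleftrightarrow>
     cs = [c] \<and> halted M A c \<and> state c = accept_state M \<or>
     (\<exists>c' cs'. tm_step M A c c' \<and> accepting_from M A c' cs' \<and> cs = c # cs')"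
proof (cases cs)
  case (Cons a cs1)
  thus ?thesis by (cases cs1) (auto simp: accepting_from_def)
qed (simp add: accepting_from_def)

text \<open>The accepting path is a function of the guessed bits, so uniqueness of the path reduces
  to uniqueness of the marked string.\<close>

fun guess_run :: "bool list \<Rightarrow> nat \<Rightarrow> bool list \<Rightarrow> bool list \<Rightarrow> config list" where
  "guess_run x i ys [] =
     [guess_config (Suc 0) x i ys, guess_config 2 x i ys, guess_config 3 x i []]"
| "guess_run x i ys (z # zs) = guess_config (Suc 0) x i ys # guess_run x (Suc i) (ys @ [z]) zs"

lemma state_guess_config [simp]: "state (guess_config q x i ys) = q"
  by (simp add: guess_config_def)

lemma accept_state_guess_machine [simp]: "accept_state (guess_machine b) = 3"
  by (simp add: guess_machine_def)

lemma accepting_from_final: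
  "accepting_from (guess_machine b) A (guess_config (if P then 3 else 4) x i []) cs \<longleftrightarrow>
    P \<and> cs = [guess_config 3 x i []]"
  by (subst accepting_from_unfold) (auto simp: guess_halted halted_def split: if_splits)

lemma accepting_from_query:
  "accepting_from (guess_machine b) A (guess_config 2 x i ys) cs \<longleftrightarrow>
    ys \<in> A \<and> cs = [guess_config 2 x i ys, guess_config 3 x i []]"
  by (subst accepting_from_unfold)
    (auto simp: halted_def guess_step_query accepting_from_final simp del: if_split)

lemma accepting_from_guess:
  assumes "i \<le> length x"
  shows "accepting_from (guess_machine b) A (guess_config (Suc 0) x i ys) cs \<longleftrightarrow>
    (\<exists>zs. length zs = length x - i \<and> ys @ zs \<in> A \<and> cs = guess_run x i ys zs)"
  using assms
proof (induction "length x - i" arbitrary: i ys cs)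
  case 0
  hence "i = length x" by simp
  thus ?case
    by (subst accepting_from_unfold) (auto simp: guess_step_end accepting_from_query)
next
  case (Suc k)
  hence i: "i < length x" by simp
  have IH: "accepting_from (guess_machine b) A (guess_config (Suc 0) x (Suc i) ys) cs \<longleftrightarrow>
    (\<exists>zs. length zs = length x - Suc i \<and> ys @ zs \<in> A \<and> cs = guess_run x (Suc i) ys zs)" for ys cs
    using Suc.hyps(1)[of "Suc i" ys cs] Suc.hyps(2) i by simp
  have len: "length x - i = Suc (length x - Suc i)" using i by simp
  have "accepting_from (guess_machine b) A (guess_config (Suc 0) x i ys) cs \<longleftrightarrow>
    (\<exists>d cs'. accepting_from (guess_machine b) A (guess_config (Suc 0) x (Suc i) (ys @ [d])) cs' \<and>
       cs = guess_config (Suc 0) x i ys # cs')"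
    by (subst accepting_from_unfold) (auto simp: guess_step_bit[OF i])
  also have "\<dots> \<longleftrightarrow> (\<exists>d zs. length zs = length x - Suc i \<and> (ys @ [d]) @ zs \<in> A \<and>
       cs = guess_config (Suc 0) x i ys # guess_run x (Suc i) (ys @ [d]) zs)"
    unfolding IH by blast
  also have "\<dots> \<longleftrightarrow> (\<exists>zs. length zs = length x - i \<and> ys @ zs \<in> A \<and> cs = guess_run x i ys zs)"
    (is "?l \<longleftrightarrow> ?r")
  proof
    assume ?l
    then obtain d zs where "length zs = length x - Suc i" "(ys @ [d]) @ zs \<in> A"
      "cs = guess_config (Suc 0) x i ys # guess_run x (Suc i) (ys @ [d]) zs" by blast
    thus ?r unfolding len by (intro exI[of _ "d # zs"]) simp
  next
    assume ?r
    then obtain d zs where "length zs = length x - Suc i" "ys @ d # zs \<in> A"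
      "cs = guess_run x i ys (d # zs)" unfolding len length_Suc_conv by blast
    thus ?l by (intro exI[of _ d] exI[of _ zs]) simp
  qed
  finally show ?case .
qed

lemma accepting_path_guess_machine:
  "accepting_path (guess_machine b) A x cs \<longleftrightarrow>
    (\<exists>zs. length zs = length x \<and> b # zs \<in> A \<and> cs = guess_config 0 x 0 [] # guess_run x 0 [b] zs)"
proof -
  have "accepting_path (guess_machine b) A x cs \<longleftrightarrow>
      accepting_from (guess_machine b) A (guess_config 0 x 0 []) cs"
    by (simp add: accepting_path_def accepting_from_def initial_config_guess)
  also have "\<dots> \<longleftrightarrow> (\<exists>cs'. accepting_from (guess_machine b) A (guess_config (Suc 0) x 0 [b]) cs' \<and>
      cs = guess_config 0 x 0 [] # cs')"
    by (subst accepting_from_unfold) (auto simp: guess_step_start)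
  also have "\<dots> \<longleftrightarrow> (\<exists>zs. length zs = length x \<and> b # zs \<in> A \<and>
      cs = guess_config 0 x 0 [] # guess_run x 0 [b] zs)"
    using accepting_from_guess[of 0 x b A "[b]"] by auto
  finally show ?thesis .
qed

text \<open>The parameter \<open>b\<close> makes the complement a language of the same form, so one
  family of machines serves both UP and coUP. Used with \<open>g n\<close> of length n + 1, so that
  there is a first bit even for the empty input.\<close>

definition marked_lang :: "(nat \<Rightarrow> bool list) \<Rightarrow> bool \<Rightarrow> bool list set" where
  "marked_lang g b = {x. hd (g (length x)) = b}"

text \<open>The strings \<open>g n\<close> have distinct lengths, so the only candidate of length n
  + 1 is \<open>g n\<close> itself, and exactly one guess can succeed, namely if it starts with
  \<open>b\<close>.\<close>

lemma marked_lang_in_UP: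
  assumes "\<And>n. length (g n) = Suc n"
  shows "marked_lang g b \<in> UP (range g)"
proof -
  have *: "accepting_path (guess_machine b) (range g) x cs \<longleftrightarrow> x \<in> marked_lang g b \<and>
    cs = guess_config 0 x 0 [] # guess_run x 0 [b] (tl (g (length x)))" for x cs
  proof -
    have "length zs = length x \<and> b # zs \<in> range g \<longleftrightarrow> b # zs = g (length x)" for zs
    proof
      assume zs: "length zs = length x \<and> b # zs \<in> range g"
      then obtain n where n: "b # zs = g n" by blast
      hence "Suc (length zs) = Suc n" using assms[of n] by (metis length_Cons)
      thus "b # zs = g (length x)" using n zs by simp
    next
      assume zs: "b # zs = g (length x)"
      hence "Suc (length zs) = Suc (length x)" using assms[of "length x"] by (metis length_Cons)
      thus "length zs = length x \<and> b # zs \<in> range g" unfolding zs by simp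
    qed
    hence "accepting_path (guess_machine b) (range g) x cs \<longleftrightarrow>
      (\<exists>zs. b # zs = g (length x) \<and> cs = guess_config 0 x 0 [] # guess_run x 0 [b] zs)"
      unfolding accepting_path_guess_machine by blast
    moreover have "g (length x) \<noteq> []" using assms[of "length x"] by auto
    ultimately show ?thesis
      unfolding marked_lang_def by (cases "g (length x)") auto
  qed
  show ?thesis
    unfolding UP_def mem_Collect_eq
    by (intro exI[of _ "guess_machine b"] conjI poly_time_guess_machine) (simp add: Ex1_def *)
qed

lemma marked_lang_in_coUP:
  assumes "\<And>n. length (g n) = Suc n"
  shows "marked_lang g b \<in> coUP (range g)"
proof -
  have "- marked_lang g b = marked_lang g (\<not> b)" by (auto simp: marked_lang_def)
  thus ?thesis unfolding coUP_def using marked_lang_in_UP[OF assms] by simp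
qed

subsection \<open>Polynomial-time computable functions and encodings\<close>

instance sym :: countable by countable_datatype
instance dir :: countable by countable_datatype
instance otm :: countable by countable_datatype

text \<open>The numbers of steps that some computation reaches are bounded; a configuration reached
  at the largest of them has no successor.\<close>

lemma poly_time_halts:
  assumes "poly_time M A"
  obtains c t where "(tm_step M A ^^ t) (initial_config M x) c" "halted M A c"
proof -
  obtain p where p: "\<And>t c. (tm_step M A ^^ t) (initial_config M x) c \<Longrightarrow> t \<le> poly p (length x)"
    using assms unfolding poly_time_def by blast
  let ?P = "\<lambda>t. \<exists>c. (tm_step M A ^^ t) (initial_config M x) c"
  have "?P 0" by auto
  moreover have "\<And>t. ?P t \<Longrightarrow> t \<le> poly p (length x)" using p by blast
  ultimately obtain t where t: "?P t" and max: "\<And>s. ?P s \<Longrightarrow> s \<le> t"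
    using GreatestI_nat[of ?P 0 "poly p (length x)"] Greatest_le_nat[of ?P _ "poly p (length x)"]
    by blast
  then obtain c where c: "(tm_step M A ^^ t) (initial_config M x) c" by blast
  have "halted M A c"
    unfolding halted_def
  proof
    assume "\<exists>c'. tm_step M A c c'"
    then obtain c' where "tm_step M A c c'" by blast
    with c have "(tm_step M A ^^ Suc t) (initial_config M x) c'" by auto
    with max[of "Suc t"] show False by auto
  qed
  with c that show ?thesis by blast
qed

text \<open>The head position belongs to the invariant, since a cell is written only under the head.
  Only the right end matters: \<open>tape_string\<close> starts at cell 0.\<close>

lemma work_tape_growth:
  assumes "(tm_step M A ^^ t) (initial_config M x) c"
  shows "work_pos c \<le> int t \<and> (\<forall>i \<ge> int (length x + t). work c i = Blank)"
  using assms
proof (induction t arbitrary: c)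
  case 0
  thus ?case by (auto simp: initial_config_def string_tape_def)
next
  case (Suc t)
  then obtain c0 where c0: "(tm_step M A ^^ t) (initial_config M x) c0" and st: "tm_step M A c0 c"
    by auto
  have sh: "shift d \<le> 1" for d by (cases d) auto
  show ?case
  proof (cases "state c0 = query_state M")
    case True
    with Suc.IH[OF c0] st show ?thesis by (auto simp: tm_step_def oracle_step_def)
  next
    case False
    then obtain a' d where "work c = (work c0)(work_pos c0 := a')"
      "work_pos c = work_pos c0 + shift d"
      using st unfolding tm_step_def by auto
    with Suc.IH[OF c0] sh[of d] show ?thesis by auto
  qed
qed

lemma poly_time_computable_length:
  assumes "poly_time_computable f"
  obtains p :: "nat poly" where "\<And>x. length (f x) \<le> poly p (length x)"
proof -
  obtain M where M: "poly_time M {}" and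
    f: "\<forall>x c. (tm_step M {})\<^sup>*\<^sup>* (initial_config M x) c \<and> halted M {} c \<longrightarrow> tape_string (work c) = f x"
    using assms unfolding poly_time_computable_def by blast
  obtain p where p: "\<And>x t c. (tm_step M {} ^^ t) (initial_config M x) c \<Longrightarrow> t \<le> poly p (length x)"
    using M unfolding poly_time_def by blast
  \<comment> \<open>The input occupies \<open>length x\<close> cells and each step adds at most
    one.\<close>
  have "length (f x) \<le> poly (p + [:0, 1:]) (length x)" for x
  proof -
    obtain c t where c: "(tm_step M {} ^^ t) (initial_config M x) c" "halted M {} c"
      by (rule poly_time_halts[OF M])
    have fx: "f x = tape_string (work c)" using f relpowp_imp_rtranclp[OF c(1)] c(2) by simp
    have "work c (int (length x + t)) = Blank" using work_tape_growth[OF c(1)] by blast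
    hence "(LEAST i::nat. \<forall>b. work c (int i) \<noteq> Bit b) \<le> length x + t"
      by (intro Least_le) auto
    hence "length (f x) \<le> length x + t" unfolding fx tape_string_def by simp
    also have "\<dots> \<le> length x + poly p (length x)" using p[OF c(1)] by simp
    finally show ?thesis by simp
  qed
  thus ?thesis using that by blast
qed

text \<open>Machines are countable, and since a polynomial-time machine halts on every input, it
  computes at most one function.\<close>

lemma countable_poly_time_computable: "countable {f. poly_time_computable f}"
proof -
  define comp where "comp f M \<longleftrightarrow> poly_time M {} \<and>
    (\<forall>x c. (tm_step M {})\<^sup>*\<^sup>* (initial_config M x) c \<and> halted M {} c \<longrightarrow> tape_string (work c) = f x)"
    for f M
  define m where "m f = (SOME M. comp f M)" for f
  have m: "comp f (m f)" if pc: "poly_time_computable f" for f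
  proof -
    obtain M where "poly_time M {}"
      "\<forall>x c. (tm_step M {})\<^sup>*\<^sup>* (initial_config M x) c \<and> halted M {} c \<longrightarrow> tape_string (work c) = f x"
      using pc unfolding poly_time_computable_def by blast
    hence "comp f M" unfolding comp_def by simp
    thus ?thesis unfolding m_def by (rule someI)
  qed
  have uniq: "f = f'" if fM: "comp f M" "comp f' M" for f f' M
  proof
    fix x
    have "poly_time M {}" using fM(1) unfolding comp_def by simp
    then obtain c t where c: "(tm_step M {} ^^ t) (initial_config M x) c" "halted M {} c"
      by (rule poly_time_halts)
    have "tape_string (work c) = f x" "tape_string (work c) = f' x"
      using fM relpowp_imp_rtranclp[OF c(1)] c(2) unfolding comp_def by blast+
    thus "f x = f' x" by simp
  qed
  have "inj_on m {f. poly_time_computable f}"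
  proof (rule inj_onI)
    fix f f' assume "f \<in> {f. poly_time_computable f}" "f' \<in> {f. poly_time_computable f}" "m f = m f'"
    thus "f = f'" using m[of f] m[of f'] uniq[of f "m f" f'] by simp
  qed
  thus ?thesis by (rule countable_image_inj_on[OF countableI_type])
qed

text \<open>Mere injectivity is lost under concatenation. Carrying the remainders \<open>r\<close>
  and \<open>s\<close> along lets codes be decoded from the left, piece by piece.\<close>

definition prefix_inj :: "('a \<Rightarrow> bool list) \<Rightarrow> bool" where
  "prefix_inj e \<longleftrightarrow> (\<forall>x y r s. e x @ r = e y @ s \<longrightarrow> x = y \<and> r = s)"

lemma prefix_injD: "prefix_inj e \<Longrightarrow> e x @ r = e y @ s \<Longrightarrow> x = y \<and> r = s"
  unfolding prefix_inj_def by blast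

lemma prefix_inj_enc_nat: "prefix_inj enc_nat"
  unfolding prefix_inj_def
proof (intro allI impI)
  fix x y :: nat and r s
  assume "enc_nat x @ r = enc_nat y @ s"
  thus "x = y \<and> r = s"
  proof (induction x arbitrary: y)
    case 0
    thus ?case by (cases y) (auto simp: enc_nat_def)
  next
    case (Suc x)
    thus ?case by (cases y) (auto simp: enc_nat_def)
  qed
qed

lemma enc_list_Cons: "enc_list e (x # xs) @ r = True # e x @ enc_list e xs @ r"
  by (simp add: enc_list_def)

lemma enc_list_Nil: "enc_list e [] @ r = False # r"
  by (simp add: enc_list_def)

lemma prefix_inj_enc_list:
  assumes "prefix_inj e"
  shows "prefix_inj (enc_list e)"
  unfolding prefix_inj_def
proof (intro allI impI)
  fix xs ys :: "'a list" and r s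
  assume "enc_list e xs @ r = enc_list e ys @ s"
  thus "xs = ys \<and> r = s"
  proof (induction xs arbitrary: ys)
    case Nil
    thus ?case by (cases ys) (auto simp: enc_list_Cons enc_list_Nil)
  next
    case (Cons x xs)
    then obtain y ys' where ys: "ys = y # ys'"
      by (cases ys) (auto simp: enc_list_Cons enc_list_Nil)
    with Cons.prems have "e x @ (enc_list e xs @ r) = e y @ (enc_list e ys' @ s)"
      by (simp add: enc_list_Cons)
    from prefix_injD[OF assms this] Cons.IH[of ys'] ys show ?case by auto
  qed
qed

lemma prefix_inj_enc_gate: "prefix_inj enc_gate"
  unfolding prefix_inj_def
proof (intro allI impI)
  fix g h r s
  assume "enc_gate g @ r = enc_gate h @ s"
  thus "g = h \<and> r = s"
    by (cases g; cases h)
      (auto dest!: prefix_injD[OF prefix_inj_enc_nat] prefix_injD[OF prefix_inj_enc_list[OF prefix_inj_enc_nat]])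
qed

lemma inj_enc_verifier: "inj enc_verifier"
proof (rule injI)
  fix V W assume "enc_verifier V = enc_verifier W"
  thus "V = W"
    using prefix_injD[OF prefix_inj_enc_list[OF prefix_inj_enc_list[OF prefix_inj_enc_gate]],
        of "circuits V" "[]" "circuits W" "[]"]
    by (cases V; cases W) (auto simp: enc_verifier_def dest!: prefix_injD[OF prefix_inj_enc_nat])
qed

lemma inj_enc_simulator: "inj enc_simulator"
proof (rule injI)
  let ?e = "\<lambda>(s, C). enc_nat s @ enc_list enc_gate C"
  have "prefix_inj ?e"
    unfolding prefix_inj_def
    by (auto dest!: prefix_injD[OF prefix_inj_enc_nat] prefix_injD[OF prefix_inj_enc_list[OF prefix_inj_enc_gate]])
  from prefix_injD[OF prefix_inj_enc_list[OF this], where r = "[]" and s = "[]", unfolded append_Nil2]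
  show "S = T" if "enc_simulator S = enc_simulator T" for S T
    using that unfolding enc_simulator_def by blast
qed

lemma length_enc_list: "length (enc_list e xs) = Suc (\<Sum>x\<leftarrow>xs. Suc (length (e x)))"
  by (induction xs) (auto simp: enc_list_def)

lemma length_enc_list_ge:
  assumes "\<And>x. x \<in> set xs \<Longrightarrow> f x \<le> length (e x)"
  shows "(\<Sum>x\<leftarrow>xs. f x) \<le> length (enc_list e xs)"
proof -
  have "(\<Sum>x\<leftarrow>xs. f x) \<le> (\<Sum>x\<leftarrow>xs. Suc (length (e x)))"
    using assms by (intro sum_list_mono) (auto intro: le_SucI)
  thus ?thesis unfolding length_enc_list by simp
qed

lemma length_le_length_enc_list: "length xs \<le> length (enc_list e xs)"
  unfolding length_enc_list by (induction xs) auto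

text \<open>Every list entry costs at least one bit. With
  \<open>poly_time_computable_length\<close>, this turns uniformity into a polynomial bound on the
  number of gates, hence of queries.\<close>

lemma gate_count_le_enc_verifier: "(\<Sum>C\<leftarrow>circuits V. length C) \<le> length (enc_verifier V)"
  using length_enc_list_ge[of "circuits V" length "enc_list enc_gate"]
  by (simp add: enc_verifier_def length_le_length_enc_list)

lemma gate_count_le_enc_simulator: "(\<Sum>(s, C)\<leftarrow>S. length C) \<le> length (enc_simulator S)"
  unfolding enc_simulator_def
  by (rule length_enc_list_ge) (auto intro!: trans_le_add2 length_le_length_enc_list)

subsection \<open>The trace norm of Hermitian matrices\<close>

lemma mat_adjoint_carrier [simp]: "A \<in> carrier_mat n m \<Longrightarrow> mat_adjoint A \<in> carrier_mat m n"
  unfolding mat_adjoint_def by auto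

lemma mat_adjoint_dims [simp]:
  "dim_row (mat_adjoint A) = dim_col A" "dim_col (mat_adjoint A) = dim_row A"
  unfolding mat_adjoint_def by auto

lemma mat_adjoint_index:
  assumes "(A :: complex mat) \<in> carrier_mat n m" "i < m" "j < n"
  shows "mat_adjoint A $$ (i, j) = cnj (A $$ (j, i))"
  using assms unfolding mat_adjoint_def by (auto simp: mat_of_rows_index)

lemma mat_adjoint_mult:
  assumes "(A :: complex mat) \<in> carrier_mat n m" "B \<in> carrier_mat m k"
  shows "mat_adjoint (A * B) = mat_adjoint B * mat_adjoint A"
proof (rule eq_matI)
  have AB: "A * B \<in> carrier_mat n k" using assms by auto
  note dims = mat_adjoint_carrier[OF AB] mat_adjoint_carrier[OF assms(1)]
    mat_adjoint_carrier[OF assms(2)]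
  show "dim_row (mat_adjoint (A * B)) = dim_row (mat_adjoint B * mat_adjoint A)"
    "dim_col (mat_adjoint (A * B)) = dim_col (mat_adjoint B * mat_adjoint A)"
    using dims by auto
  fix i j assume "i < dim_row (mat_adjoint B * mat_adjoint A)"
    "j < dim_col (mat_adjoint B * mat_adjoint A)"
  hence ij: "i < k" "j < n" using dims by auto
  show "mat_adjoint (A * B) $$ (i, j) = (mat_adjoint B * mat_adjoint A) $$ (i, j)"
    using assms ij dims
    by (auto simp: mat_adjoint_index[OF AB] scalar_prod_def mat_adjoint_index[OF assms(1)]
        mat_adjoint_index[OF assms(2)] mult.commute intro!: sum.cong)
qed

lemma mat_adjoint_mat_adjoint:
  assumes "(A :: complex mat) \<in> carrier_mat n m"
  shows "mat_adjoint (mat_adjoint A) = A"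
proof (rule eq_matI)
  note a = mat_adjoint_carrier[OF assms] mat_adjoint_carrier[OF mat_adjoint_carrier[OF assms]]
  show "dim_row (mat_adjoint (mat_adjoint A)) = dim_row A"
    "dim_col (mat_adjoint (mat_adjoint A)) = dim_col A"
    using a assms by auto
  fix i j assume "i < dim_row A" "j < dim_col A"
  thus "mat_adjoint (mat_adjoint A) $$ (i, j) = A $$ (i, j)"
    using assms by (auto simp: mat_adjoint_index[OF a(1)] mat_adjoint_index[OF assms])
qed

lemma index_mult_mat_sum:
  assumes "A \<in> carrier_mat n m" "B \<in> carrier_mat m k" "i < n" "j < k"
  shows "(A * B) $$ (i, j) = (\<Sum>a<m. A $$ (i, a) * B $$ (a, j))"
  using assms by (auto simp: scalar_prod_def atLeast0LessThan)

text \<open>Complete \<open>v\<close> to a basis and apply Gram-Schmidt, which keeps the first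
  vector; dividing each vector by its norm gives orthonormal columns. The scalar is the inverse norm
  of \<open>v\<close>.\<close>

lemma unitary_completion:
  fixes v :: "complex Matrix.vec"
  assumes v: "v \<in> carrier_vec n" and v0: "v \<noteq> 0\<^sub>v n"
  shows "\<exists>W c. W \<in> carrier_mat n n \<and> mat_adjoint W * W = 1\<^sub>m n \<and> col W 0 = c \<cdot>\<^sub>v v"
proof -
  interpret cof_vec_space n "TYPE(complex)" .
  define b where "b = basis_completion v"
  define ws where "ws = gram_schmidt n b"
  from basis_completion[OF v v0, folded b_def]
  have dist_b: "distinct b" and indep: "\<not> lin_dep (set b)" and b: "set b \<subseteq> carrier_vec n"
    and hdb: "hd b = v" and len_b: "length b = n" by auto
  have n: "n \<noteq> 0"
  proof
    assume "n = 0"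
    hence "v = 0\<^sub>v n" using v by (intro eq_vecI) simp_all
    with v0 show False by simp
  qed
  from hdb len_b n obtain vs where bv: "b = v # vs" by (cases b, auto)
  from gram_schmidt_result[OF b dist_b indep refl, folded ws_def]
  have ws: "set ws \<subseteq> carrier_vec n" "corthogonal ws" "length ws = n"
    by (auto simp: len_b)
  from gram_schmidt_hd[OF v, of vs, folded bv] have hdws: "hd ws = v" unfolding ws_def .
  have wc: "ws ! i \<in> carrier_vec n" if "i < n" for i using ws that by auto
  define q where "q i = (\<Sum>a<n. (cmod (ws ! i $ a))\<^sup>2)" for i
  define c where "c i = complex_of_real (1 / sqrt (q i))" for i
  define W where "W = mat n n (\<lambda>(a, i). c i * ws ! i $ a)"
  have W: "W \<in> carrier_mat n n" unfolding W_def by auto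
  have Wi: "W $$ (a, i) = c i * ws ! i $ a" if "a < n" "i < n" for a i
    using that by (simp add: W_def)
  have ip: "(\<Sum>a<n. ws ! i $ a * cnj (ws ! j $ a)) = (if i = j then complex_of_real (q i) else 0)"
    if "i < n" "j < n" for i j
  proof -
    have eq: "ws ! i \<bullet>c ws ! j = (\<Sum>a<n. ws ! i $ a * cnj (ws ! j $ a))"
      using wc[OF that(1)] wc[OF that(2)] by (auto simp: scalar_prod_def atLeast0LessThan)
    show ?thesis
    proof (cases "i = j")
      case True
      thus ?thesis unfolding q_def of_real_sum complex_norm_square by simp
    next
      case False
      hence "ws ! i \<bullet>c ws ! j = 0" using corthogonalD[OF ws(2), of i j] that ws(3) by simp
      thus ?thesis using False unfolding eq by simp
    qed
  qed
  have q0: "q i > 0" if "i < n" for i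
  proof -
    have "ws ! i \<bullet>c ws ! i \<noteq> 0" using corthogonalD[OF ws(2), of i i] that ws(3) by simp
    moreover have "ws ! i \<bullet>c ws ! i = (\<Sum>a<n. ws ! i $ a * cnj (ws ! i $ a))"
      using wc[OF that(1)] by (auto simp: scalar_prod_def atLeast0LessThan)
    ultimately have "q i \<noteq> 0" using ip[OF that that] by auto
    moreover have "q i \<ge> 0" unfolding q_def by (intro sum_nonneg) auto
    ultimately show ?thesis by simp
  qed
  have "mat_adjoint W * W = 1\<^sub>m n"
  proof (rule eq_matI)
    fix i j assume "i < dim_row (1\<^sub>m n :: complex mat)" "j < dim_col (1\<^sub>m n :: complex mat)"
    hence ij: "i < n" "j < n" by auto
    have "(mat_adjoint W * W) $$ (i, j) = (\<Sum>a<n. mat_adjoint W $$ (i, a) * W $$ (a, j))"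
      by (rule index_mult_mat_sum[OF mat_adjoint_carrier[OF W] W ij])
    also have "\<dots> = (\<Sum>a<n. c i * c j * (ws ! j $ a * cnj (ws ! i $ a)))"
    proof (intro sum.cong refl)
      fix a assume "a \<in> {..<n}"
      hence a: "a < n" by simp
      show "mat_adjoint W $$ (i, a) * W $$ (a, j) = c i * c j * (ws ! j $ a * cnj (ws ! i $ a))"
        unfolding mat_adjoint_index[OF W ij(1) a] Wi[OF a ij(1)] Wi[OF a ij(2)] by (simp add: c_def)
    qed
    also have "\<dots> = c i * c j * (if j = i then complex_of_real (q j) else 0)"
      using ip[OF ij(2) ij(1)] by (simp add: sum_distrib_left[symmetric])
    also have "\<dots> = (if i = j then 1 else 0)"
    proof (cases "i = j")
      case True
      have "1 / sqrt (q i) * (1 / sqrt (q i)) * q i = 1" using q0[OF ij(1)] by simp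
      hence "c i * c i * complex_of_real (q i) = 1"
        unfolding c_def of_real_mult[symmetric] by (simp only: of_real_1)
      thus ?thesis using True by simp
    qed simp
    finally show "(mat_adjoint W * W) $$ (i, j) = (1\<^sub>m n) $$ (i, j)"
      using ij by simp
  qed (use W mat_adjoint_carrier[OF W] in auto)
  moreover have "col W 0 = c 0 \<cdot>\<^sub>v v"
  proof -
    have "ws ! 0 = v" using hdws hd_conv_nth[of ws] ws(3) n by auto
    thus ?thesis using carrier_vecD[OF v] n by (intro eq_vecI) (simp_all add: W_def)
  qed
  ultimately show ?thesis by (intro exI[of _ W] exI[of _ "c 0"] conjI W)
qed

definition diag_of :: "nat \<Rightarrow> (nat \<Rightarrow> complex) \<Rightarrow> complex mat" where
  "diag_of n d = mat n n (\<lambda>(i, j). if i = j then d i else 0)"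

lemma diag_of_carrier [simp]: "diag_of n d \<in> carrier_mat n n"
  unfolding diag_of_def by auto

lemma unitary_right_inverse:
  assumes "(P :: complex mat) \<in> carrier_mat n n" "mat_adjoint P * P = 1\<^sub>m n"
  shows "P * mat_adjoint P = 1\<^sub>m n"
  using mat_mult_left_right_inverse[OF mat_adjoint_carrier[OF assms(1)] assms(1) assms(2)] .

lemma mult_mat_reassoc4:
  assumes A: "(A :: 'a :: semiring_0 mat) \<in> carrier_mat n n" and B: "B \<in> carrier_mat n n"
    and C: "C \<in> carrier_mat n n" and D: "D \<in> carrier_mat n n"
  shows "(A * B) * (C * D) = A * (B * C) * D"
  unfolding assoc_mult_mat[OF A B mult_carrier_mat[OF C D]] assoc_mult_mat[OF B C D, symmetric]
  by (rule assoc_mult_mat[OF A mult_carrier_mat[OF B C] D, symmetric])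

lemma mult_mat_reassoc5:
  assumes A: "(A :: 'a :: semiring_0 mat) \<in> carrier_mat n n" and B: "B \<in> carrier_mat n n"
    and C: "C \<in> carrier_mat n n" and D: "D \<in> carrier_mat n n" and E: "E \<in> carrier_mat n n"
  shows "A * (B * C * D) * E = (A * B) * C * (D * E)"
  unfolding assoc_mult_mat[OF A mult_carrier_mat[OF B C] D, symmetric]
    assoc_mult_mat[OF A B C, symmetric]
  by (rule assoc_mult_mat[OF mult_carrier_mat[OF mult_carrier_mat[OF A B] C] D E])

text \<open>The block diagonal matrix with the 1 by 1 block \<open>x\<close> followed by
  \<open>M\<close>.\<close>

definition block_ext :: "nat \<Rightarrow> complex \<Rightarrow> complex mat \<Rightarrow> complex mat" where
  "block_ext m x M = mat (Suc m) (Suc m)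
     (\<lambda>(i, j). if i = 0 \<or> j = 0 then (if i = j then x else 0) else M $$ (i - 1, j - 1))"

lemma block_ext_carrier [simp]: "block_ext m x M \<in> carrier_mat (Suc m) (Suc m)"
  unfolding block_ext_def by auto

lemma block_ext_mult:
  assumes M: "M \<in> carrier_mat m m" and N: "N \<in> carrier_mat m m"
  shows "block_ext m x M * block_ext m y N = block_ext m (x * y) (M * N)"
proof (rule eq_matI)
  fix i j
  assume "i < dim_row (block_ext m (x * y) (M * N))" "j < dim_col (block_ext m (x * y) (M * N))"
  hence ij: "i < Suc m" "j < Suc m" by (auto simp: block_ext_def)
  have "(block_ext m x M * block_ext m y N) $$ (i, j) =
      (\<Sum>a<Suc m. block_ext m x M $$ (i, a) * block_ext m y N $$ (a, j))"
    by (rule index_mult_mat_sum[OF block_ext_carrier block_ext_carrier ij])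
  also have "\<dots> = block_ext m x M $$ (i, 0) * block_ext m y N $$ (0, j) +
      (\<Sum>a<m. block_ext m x M $$ (i, Suc a) * block_ext m y N $$ (Suc a, j))"
    by (rule sum.lessThan_Suc_shift)
  also have "\<dots> = block_ext m (x * y) (M * N) $$ (i, j)"
    using ij index_mult_mat_sum[OF M N, of "i - 1" "j - 1"]
    by (cases i; cases j) (simp_all add: block_ext_def del: index_mult_mat)
  finally show "(block_ext m x M * block_ext m y N) $$ (i, j) =
      block_ext m (x * y) (M * N) $$ (i, j)" .
qed (auto simp: block_ext_def)

lemma block_ext_adjoint:
  assumes M: "M \<in> carrier_mat m m"
  shows "mat_adjoint (block_ext m x M) = block_ext m (cnj x) (mat_adjoint M)"
proof (rule eq_matI)
  fix i j
  assume "i < dim_row (block_ext m (cnj x) (mat_adjoint M))"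
    "j < dim_col (block_ext m (cnj x) (mat_adjoint M))"
  hence ij: "i < Suc m" "j < Suc m" by (auto simp: block_ext_def)
  show "mat_adjoint (block_ext m x M) $$ (i, j) = block_ext m (cnj x) (mat_adjoint M) $$ (i, j)"
    unfolding mat_adjoint_index[OF block_ext_carrier ij]
    using ij by (cases i; cases j) (simp_all add: block_ext_def mat_adjoint_index[OF M])
qed (auto simp: block_ext_def)

text \<open>The spectral theorem by deflation: conjugation with a unitary whose first column is an
  eigenvector clears the first column, Hermitian symmetry then clears the first row, and the
  induction applies to the remaining block. The entries \<open>d\<close> are left complex, since the
  trace norm sees only their moduli.\<close>

lemma hermitian_unitary_diagonalization:
  fixes A :: "complex mat"
  assumes "A \<in> carrier_mat n n" "mat_adjoint A = A"
  shows "\<exists>P d. P \<in> carrier_mat n n \<and> mat_adjoint P * P = 1\<^sub>m n \<and>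
           A = P * diag_of n d * mat_adjoint P"
  using assms
proof (induction n arbitrary: A)
  case 0
  hence "A = 1\<^sub>m 0 * diag_of 0 (\<lambda>_. 0) * mat_adjoint (1\<^sub>m 0)"
    using mat_adjoint_carrier[of "1\<^sub>m 0 :: complex mat" 0 0] by (intro eq_matI) auto
  moreover have "mat_adjoint (1\<^sub>m 0 :: complex mat) * 1\<^sub>m 0 = 1\<^sub>m 0"
    using mat_adjoint_carrier[of "1\<^sub>m 0 :: complex mat" 0 0] by (intro eq_matI) auto
  ultimately show ?case using one_carrier_mat[of 0, where ?'a = complex] by blast
next
  case (Suc m)
  let ?n = "Suc m"
  note A = Suc.prems(1)
  obtain as where as: "char_poly A = (\<Prod>a\<leftarrow>as. [:- a, 1:])" "length as = ?n"
    using char_poly_factorized[OF A] by blast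
  then obtain e as' where "as = e # as'" by (cases as) auto
  hence "poly (char_poly A) e = 0" using as by simp
  hence ev: "eigenvalue A e" using eigenvalue_root_char_poly[OF A] by simp
  then obtain v where v: "v \<in> carrier_vec ?n" "v \<noteq> 0\<^sub>v ?n" "A *\<^sub>v v = e \<cdot>\<^sub>v v"
    using A unfolding eigenvalue_def eigenvector_def by auto
  obtain W c where W: "W \<in> carrier_mat ?n ?n" and WW: "mat_adjoint W * W = 1\<^sub>m ?n"
    and c: "col W 0 = c \<cdot>\<^sub>v v"
    using unitary_completion[OF v(1,2)] by blast
  note W' = mat_adjoint_carrier[OF W]
  define B where "B = mat_adjoint W * A * W"
  have B: "B \<in> carrier_mat ?n ?n" using W W' A unfolding B_def by auto
  have hB: "mat_adjoint B = B"
    unfolding B_def mat_adjoint_mult[OF mult_carrier_mat[OF W' A] W] mat_adjoint_mult[OF W' A]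
      mat_adjoint_mat_adjoint[OF W] Suc.prems(2) by (rule assoc_mult_mat[OF W' A W, symmetric])
  have col0: "B $$ (i, 0) = (if i = 0 then e else 0)" if "i < ?n" for i
  proof -
    \<comment> \<open>A multiple of an eigenvector satisfies the same equation; so column 0 of
      \<open>B\<close> is \<open>e\<close> times column 0 of the identity.\<close>
    have "A *\<^sub>v col W 0 = e \<cdot>\<^sub>v col W 0"
      unfolding c using v A by (auto simp: mult_mat_vec smult_smult_assoc mult.commute)
    hence 1: "col (A * W) 0 = e \<cdot>\<^sub>v col W 0"
      using A W col_mult2[OF A W, of 0] by simp
    have "B = mat_adjoint W * (A * W)" unfolding B_def by (rule assoc_mult_mat[OF W' A W])
    hence "B $$ (i, 0) = row (mat_adjoint W) i \<bullet> (e \<cdot>\<^sub>v col W 0)"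
      using that A W W' 1 by auto
    also have "\<dots> = e * (row (mat_adjoint W) i \<bullet> col W 0)"
      using W W' that by simp
    also have "row (mat_adjoint W) i \<bullet> col W 0 = (mat_adjoint W * W) $$ (i, 0)"
      using W W' that by auto
    finally show ?thesis unfolding WW using that by auto
  qed
  have row0: "B $$ (0, i) = (if i = 0 then e else 0)" if "i < ?n" for i
  proof (cases "i = 0")
    case False
    have "B $$ (0, i) = cnj (B $$ (i, 0))"
      using mat_adjoint_index[OF B, of 0 i] that unfolding hB by simp
    thus ?thesis using col0[OF that] False by simp
  qed (use col0 in auto)
  define A3 where "A3 = mat m m (\<lambda>(i, j). B $$ (Suc i, Suc j))"
  have A3: "A3 \<in> carrier_mat m m" unfolding A3_def by auto
  have hA3: "mat_adjoint A3 = A3"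
  proof (rule eq_matI)
    fix i j assume "i < dim_row A3" "j < dim_col A3"
    hence ij: "i < m" "j < m" using A3 by auto
    have "B $$ (Suc i, Suc j) = cnj (B $$ (Suc j, Suc i))"
      using mat_adjoint_index[OF B, of "Suc i" "Suc j"] ij unfolding hB by simp
    thus "mat_adjoint A3 $$ (i, j) = A3 $$ (i, j)"
      using ij by (subst mat_adjoint_index[OF A3]) (simp_all add: A3_def)
  qed (use A3 mat_adjoint_carrier[OF A3] in auto)
  obtain P3 d3 where P3: "P3 \<in> carrier_mat m m" and PP3: "mat_adjoint P3 * P3 = 1\<^sub>m m"
    and AP3: "A3 = P3 * diag_of m d3 * mat_adjoint P3"
    using Suc.IH[OF A3 hA3] by blast
  note P3' = mat_adjoint_carrier[OF P3]
  define d where "d i = (case i of 0 \<Rightarrow> e | Suc k \<Rightarrow> d3 k)" for i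
  let ?bl = "block_ext m"
  define Q where "Q = ?bl 1 P3"
  have Q: "Q \<in> carrier_mat ?n ?n" unfolding Q_def by simp
  have Q': "mat_adjoint Q = ?bl 1 (mat_adjoint P3)"
    unfolding Q_def using block_ext_adjoint[OF P3, of 1] by simp
  have bD: "diag_of ?n d = ?bl e (diag_of m d3)"
  proof (rule eq_matI)
    fix i j assume "i < dim_row (?bl e (diag_of m d3))" "j < dim_col (?bl e (diag_of m d3))"
    thus "diag_of ?n d $$ (i, j) = ?bl e (diag_of m d3) $$ (i, j)"
      by (cases i; cases j) (auto simp: diag_of_def d_def block_ext_def)
  qed (auto simp: diag_of_def block_ext_def)
  have b1: "1\<^sub>m ?n = ?bl 1 (1\<^sub>m m)"
  proof (rule eq_matI)
    fix i j assume "i < dim_row (?bl 1 (1\<^sub>m m))" "j < dim_col (?bl 1 (1\<^sub>m m))"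
    thus "1\<^sub>m ?n $$ (i, j) = ?bl 1 (1\<^sub>m m) $$ (i, j)"
      by (cases i; cases j) (auto simp: block_ext_def)
  qed (auto simp: block_ext_def)
  have QQ: "mat_adjoint Q * Q = 1\<^sub>m ?n"
    unfolding Q' unfolding Q_def b1 block_ext_mult[OF P3' P3] PP3 by (simp only: mult_1_left)
  have Bbl: "B = ?bl e A3"
  proof (rule eq_matI)
    fix i j assume "i < dim_row (?bl e A3)" "j < dim_col (?bl e A3)"
    hence ij: "i < ?n" "j < ?n" by (auto simp: block_ext_def)
    show "B $$ (i, j) = ?bl e A3 $$ (i, j)"
      using ij col0[OF ij(1)] row0[OF ij(2)]
      by (cases i; cases j) (auto simp: A3_def block_ext_def)
  qed (use B in \<open>auto simp: block_ext_def\<close>)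
  have BQ: "B = Q * diag_of ?n d * mat_adjoint Q"
    unfolding Q' bD unfolding Q_def Bbl block_ext_mult[OF P3 diag_of_carrier]
      block_ext_mult[OF mult_carrier_mat[OF P3 diag_of_carrier] P3'] AP3
    by (simp only: mult_1_left mult_1_right)
  define P where "P = W * Q"
  have P: "P \<in> carrier_mat ?n ?n" unfolding P_def using W Q by auto
  note Qc = mat_adjoint_carrier[OF Q]
  have P': "mat_adjoint P = mat_adjoint Q * mat_adjoint W"
    unfolding P_def by (rule mat_adjoint_mult[OF W Q])
  have "mat_adjoint P * P = mat_adjoint Q * (mat_adjoint W * W) * Q"
    unfolding P' unfolding P_def using mult_mat_reassoc4[OF Qc W' W Q] .
  also have "\<dots> = 1\<^sub>m ?n" unfolding WW right_mult_one_mat[OF Qc] by (rule QQ)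
  finally have PP: "mat_adjoint P * P = 1\<^sub>m ?n" .
  have "W * B * mat_adjoint W = (W * mat_adjoint W) * A * (W * mat_adjoint W)"
    unfolding B_def by (rule mult_mat_reassoc5[OF W W' A W W'])
  also have "\<dots> = A"
    unfolding unitary_right_inverse[OF W WW] left_mult_one_mat[OF A] by (rule right_mult_one_mat[OF A])
  finally have "A = W * B * mat_adjoint W" by (rule sym)
  also have "\<dots> = (W * Q) * diag_of ?n d * (mat_adjoint Q * mat_adjoint W)"
    unfolding BQ by (rule mult_mat_reassoc5[OF W Q diag_of_carrier Qc W'])
  finally have "A = P * diag_of ?n d * mat_adjoint P" unfolding P' unfolding P_def .
  thus ?case using P PP by blast
qed

text \<open>A sum over roots with multiplicity is the sum over the list of linear factors. The set
  \<open>S\<close> may exceed the set of roots, so that it stays fixed while the induction shortens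
  the list.\<close>

lemma sum_order_prod_linear:
  fixes f :: "'a :: idom \<Rightarrow> real"
  assumes "finite S" "set es \<subseteq> S"
  shows "(\<Sum>a\<in>S. real (Polynomial.order a (\<Prod>e\<leftarrow>es. [:- e, 1:])) * f a) = (\<Sum>e\<leftarrow>es. f e)"
  using assms(2)
proof (induction es)
  case Nil
  thus ?case by simp
next
  case (Cons e es)
  let ?p = "\<Prod>e\<leftarrow>es. [:- e, 1:]"
  have p0: "?p \<noteq> 0" by auto
  hence p1: "[:- e, 1:] * ?p \<noteq> 0" by (simp del: mult_pCons_left)
  have ord: "Polynomial.order a ([:- e, 1:] * ?p) = (if a = e then 1 else 0) + Polynomial.order a ?p" for a
    using order_power_n_n[of e 1] by (subst order_mult[OF p1]) (auto simp: order_0I)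
  have "(\<Sum>a\<in>S. real (Polynomial.order a ([:- e, 1:] * ?p)) * f a) =
    (\<Sum>a\<in>S. (if a = e then f a else 0) + real (Polynomial.order a ?p) * f a)"
    unfolding ord by (intro sum.cong) (auto simp: algebra_simps)
  also have "\<dots> = f e + (\<Sum>e\<leftarrow>es. f e)"
    using Cons assms(1) by (simp add: sum.distrib sum.delta')
  finally show ?case by simp
qed

text \<open>For A = P D P* with P unitary, A* A is similar to the diagonal matrix of the squared
  moduli, so its characteristic polynomial has exactly these as roots, with multiplicity.\<close>

lemma trace_norm_diagonalized:
  assumes P: "P \<in> carrier_mat n n" and PP: "mat_adjoint P * P = 1\<^sub>m n"
  shows "trace_norm (P * diag_of n d * mat_adjoint P) = (\<Sum>i<n. cmod (d i))"
proof -
  let ?D = "diag_of n d" and ?D' = "mat_adjoint (diag_of n d)"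
  let ?A = "P * ?D * mat_adjoint P"
  let ?S = "diag_of n (\<lambda>i. complex_of_real ((cmod (d i))\<^sup>2))"
  note P' = mat_adjoint_carrier[OF P] and Dc = mat_adjoint_carrier[OF diag_of_carrier[of n d]]
  have "mat_adjoint ?A = P * ?D' * mat_adjoint P"
    unfolding mat_adjoint_mult[OF mult_carrier_mat[OF P diag_of_carrier] P']
      mat_adjoint_mult[OF P diag_of_carrier] mat_adjoint_mat_adjoint[OF P]
    by (rule assoc_mult_mat[OF P Dc P', symmetric])
  hence "mat_adjoint ?A * ?A = (P * ?D') * mat_adjoint P * (P * (?D * mat_adjoint P))"
    unfolding assoc_mult_mat[OF P diag_of_carrier P'] by simp
  also have "\<dots> = (P * ?D') * ((mat_adjoint P * P) * (?D * mat_adjoint P))"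
    unfolding
      assoc_mult_mat[OF mult_carrier_mat[OF P Dc] P'
        mult_carrier_mat[OF P mult_carrier_mat[OF diag_of_carrier P']]]
      assoc_mult_mat[OF P' P mult_carrier_mat[OF diag_of_carrier P']] ..
  also have "\<dots> = P * (?D' * (?D * mat_adjoint P))"
    unfolding PP left_mult_one_mat[OF mult_carrier_mat[OF diag_of_carrier P']]
    by (rule assoc_mult_mat[OF P Dc mult_carrier_mat[OF diag_of_carrier P']])
  also have "\<dots> = P * ((?D' * ?D) * mat_adjoint P)"
    by (subst assoc_mult_mat[OF Dc diag_of_carrier P'], rule refl)
  also have "\<dots> = P * (?D' * ?D) * mat_adjoint P"
    by (rule assoc_mult_mat[OF P mult_carrier_mat[OF Dc diag_of_carrier] P', symmetric])
  also have "?D' * ?D = ?S"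
  proof (rule eq_matI)
    fix i j assume "i < dim_row ?S" "j < dim_col ?S"
    hence ij: "i < n" "j < n" by (auto simp: diag_of_def)
    have D'i: "?D' $$ (i, a) = (if a = i then cnj (d i) else 0)" if "a < n" for a
      using that ij by (subst mat_adjoint_index[OF diag_of_carrier]) (auto simp: diag_of_def)
    have "(?D' * ?D) $$ (i, j) = (\<Sum>a<n. ?D' $$ (i, a) * ?D $$ (a, j))"
      by (rule index_mult_mat_sum[OF Dc diag_of_carrier ij])
    also have "\<dots> = (\<Sum>a<n. if a = i then (if i = j then cnj (d i) * d i else 0) else 0)"
      using ij by (intro sum.cong) (auto simp: D'i, auto simp: diag_of_def)
    finally show "(?D' * ?D) $$ (i, j) = ?S $$ (i, j)"
      using ij by (simp add: diag_of_def complex_norm_square mult.commute flip: of_real_power)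
  qed (use Dc in \<open>auto simp: diag_of_def\<close>)
  finally have eq: "mat_adjoint ?A * ?A = P * ?S * mat_adjoint P" .
  have "similar_mat_wit (mat_adjoint ?A * ?A) ?S P (mat_adjoint P)"
    unfolding eq by (rule similar_mat_witI[of _ _ n])
      (use P P' PP unitary_right_inverse[OF P PP] in \<open>auto simp: diag_of_def\<close>)
  hence "char_poly (mat_adjoint ?A * ?A) = char_poly ?S"
    by (intro char_poly_similar) (auto simp: similar_mat_def)
  also have "\<dots> = (\<Prod>a\<leftarrow>diag_mat ?S. [:- a, 1:])"
    by (rule char_poly_upper_triangular[of _ n]) (auto simp: diag_of_def)
  also have "diag_mat ?S = map (\<lambda>i. complex_of_real ((cmod (d i))\<^sup>2)) [0..<n]"
    by (auto simp: diag_mat_def diag_of_def)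
  finally have cp: "char_poly (mat_adjoint ?A * ?A) =
    (\<Prod>a\<leftarrow>map (\<lambda>i. complex_of_real ((cmod (d i))\<^sup>2)) [0..<n]. [:- a, 1:])" .
  let ?es = "map (\<lambda>i. complex_of_real ((cmod (d i))\<^sup>2)) [0..<n]"
  have roots: "{a. poly (\<Prod>a\<leftarrow>?es. [:- a, 1:]) a = 0} = set ?es"
    by (subst poly_prod_list) (auto simp: prod_list_zero_iff)
  have "trace_norm ?A = (\<Sum>e\<leftarrow>?es. sqrt (Re e))"
    unfolding trace_norm_def Let_def cp roots
    by (rule sum_order_prod_linear) auto
  also have "\<dots> = (\<Sum>i<n. cmod (d i))"
    by (simp add: o_def interv_sum_list_conv_sum_set_nat atLeast0LessThan del: of_real_power)
  finally show ?thesis .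
qed

text \<open>Duality of trace norm and operator norm: the left-hand side is the modulus of Tr(E X).
  Writing X as a sum of d_i v_i v_i* with unit vectors v_i bounds it by the sum of |d_i| |v_i* E
  v_i|, and the assumption on \<open>E\<close> makes each second factor at most 1.\<close>

lemma trace_norm_ge_quadratic_form:
  fixes X :: "complex mat" and E :: "nat \<Rightarrow> nat \<Rightarrow> complex"
  assumes X: "X \<in> carrier_mat n n" "mat_adjoint X = X"
    and E: "\<And>v. cmod (\<Sum>a<n. \<Sum>b<n. E b a * (v a * cnj (v b))) \<le> (\<Sum>a<n. (cmod (v a))\<^sup>2)"
  shows "cmod (\<Sum>a<n. \<Sum>b<n. E b a * X $$ (a, b)) \<le> trace_norm X"
proof -
  obtain P d where P: "P \<in> carrier_mat n n" and PP: "mat_adjoint P * P = 1\<^sub>m n"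
    and XP: "X = P * diag_of n d * mat_adjoint P"
    using hermitian_unitary_diagonalization[OF X] by blast
  note P' = mat_adjoint_carrier[OF P]
  let ?v = "\<lambda>i a. P $$ (a, i)"
  have Xab: "X $$ (a, b) = (\<Sum>i<n. d i * (?v i a * cnj (?v i b)))" if "a < n" "b < n" for a b
  proof -
    have PD: "(P * diag_of n d) $$ (a, i) = P $$ (a, i) * d i" if "i < n" for i
    proof -
      have "(P * diag_of n d) $$ (a, i) = (\<Sum>j<n. P $$ (a, j) * diag_of n d $$ (j, i))"
        by (rule index_mult_mat_sum[OF P diag_of_carrier \<open>a < n\<close> that])
      also have "\<dots> = (\<Sum>j<n. if j = i then P $$ (a, i) * d i else 0)"
        using that by (intro sum.cong) (auto simp: diag_of_def)
      finally show ?thesis using that by simp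
    qed
    have "X $$ (a, b) = (\<Sum>i<n. (P * diag_of n d) $$ (a, i) * mat_adjoint P $$ (i, b))"
      unfolding XP by (rule index_mult_mat_sum[OF mult_carrier_mat[OF P diag_of_carrier] P' that])
    also have "\<dots> = (\<Sum>i<n. d i * (?v i a * cnj (?v i b)))"
      using that by (intro sum.cong) (auto simp: mat_adjoint_index[OF P] PD)
    finally show ?thesis .
  qed
  have nrm: "(\<Sum>a<n. (cmod (?v i a))\<^sup>2) = 1" if "i < n" for i
  proof -
    have "complex_of_real (\<Sum>a<n. (cmod (?v i a))\<^sup>2) = (\<Sum>a<n. mat_adjoint P $$ (i, a) * P $$ (a, i))"
      unfolding of_real_sum using that
      by (intro sum.cong) (auto simp: mat_adjoint_index[OF P] complex_norm_square mult.commute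
          simp flip: of_real_power)
    also have "\<dots> = (mat_adjoint P * P) $$ (i, i)"
      by (rule index_mult_mat_sum[OF P' P that that, symmetric])
    also have "\<dots> = 1" unfolding PP using that by simp
    finally show ?thesis using of_real_eq_1_iff by blast
  qed
  have "(\<Sum>a<n. \<Sum>b<n. E b a * X $$ (a, b)) =
    (\<Sum>a<n. \<Sum>b<n. \<Sum>i<n. d i * (E b a * (?v i a * cnj (?v i b))))"
    by (intro sum.cong refl) (auto simp: Xab sum_distrib_left mult_ac)
  also have "\<dots> = (\<Sum>a<n. \<Sum>i<n. \<Sum>b<n. d i * (E b a * (?v i a * cnj (?v i b))))"
    by (intro sum.cong refl sum.swap)
  also have "\<dots> = (\<Sum>i<n. \<Sum>a<n. \<Sum>b<n. d i * (E b a * (?v i a * cnj (?v i b))))"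
    by (rule sum.swap)
  also have "\<dots> = (\<Sum>i<n. d i * (\<Sum>a<n. \<Sum>b<n. E b a * (?v i a * cnj (?v i b))))"
    by (simp add: sum_distrib_left)
  also have "cmod \<dots> \<le> (\<Sum>i<n. cmod (d i) * 1)"
  proof (rule sum_norm_le)
    fix i assume "i \<in> {..<n}"
    thus "cmod (d i * (\<Sum>a<n. \<Sum>b<n. E b a * (?v i a * cnj (?v i b)))) \<le> cmod (d i) * 1"
      unfolding norm_mult using E[of "?v i"] nrm[of i] by (intro mult_left_mono) auto
  qed
  finally show ?thesis unfolding XP using trace_norm_diagonalized[OF P PP, of d] by simp
qed

subsection \<open>Query weights and the hybrid argument\<close>

lemma finite_bits [simp]: "finite (bits n)"
  using finite_lists_length_eq[of "UNIV :: bool set" n] by simp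

lemma card_bits: "card (bits n) = 2 ^ n"
  using card_lists_length_eq[of "UNIV :: bool set" n] by simp

abbreviation qnorm_on :: "bool list set \<Rightarrow> qstate \<Rightarrow> real" where
  "qnorm_on S \<psi> \<equiv> L2_set (\<lambda>x. cmod (\<psi> x)) S"

lemma qnorm_on_diff_le: "qnorm_on S (\<lambda>x. \<phi> x - \<psi> x) \<le> qnorm_on S \<phi> + qnorm_on S \<psi>"
proof -
  have "qnorm_on S (\<lambda>x. \<phi> x - \<psi> x) \<le> L2_set (\<lambda>x. cmod (\<phi> x) + cmod (\<psi> x)) S"
    by (intro L2_set_mono) (auto intro: norm_triangle_ineq4)
  also have "\<dots> \<le> qnorm_on S \<phi> + qnorm_on S \<psi>" by (rule L2_set_triangle_ineq)
  finally show ?thesis .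
qed

lemma qnorm_on_triangle:
  "qnorm_on S (\<lambda>x. \<phi> x - \<chi> x) \<le> qnorm_on S (\<lambda>x. \<phi> x - \<psi> x) + qnorm_on S (\<lambda>x. \<psi> x - \<chi> x)"
proof -
  have "qnorm_on S (\<lambda>x. \<phi> x - \<chi> x) \<le> L2_set (\<lambda>x. cmod (\<phi> x - \<psi> x) + cmod (\<psi> x - \<chi> x)) S"
  proof (intro L2_set_mono)
    show "cmod (\<phi> x - \<chi> x) \<le> cmod (\<phi> x - \<psi> x) + cmod (\<psi> x - \<chi> x)" for x
      using norm_triangle_ineq[of "\<phi> x - \<psi> x" "\<psi> x - \<chi> x"] by simp
  qed simp
  also have "\<dots> \<le> qnorm_on S (\<lambda>x. \<phi> x - \<psi> x) + qnorm_on S (\<lambda>x. \<psi> x - \<chi> x)"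
    by (rule L2_set_triangle_ineq)
  finally show ?thesis .
qed

lemma qnorm_on_subset:
  assumes "S \<subseteq> T" "finite T"
  shows "qnorm_on S \<psi> \<le> qnorm_on T \<psi>"
  unfolding L2_set_def using assms by (intro real_sqrt_le_mono sum_mono2) auto

lemma qnorm_on_power2: "(qnorm_on S \<psi>)\<^sup>2 = (\<Sum>x\<in>S. (cmod (\<psi> x))\<^sup>2)"
  unfolding L2_set_def by (intro real_sqrt_pow2 sum_nonneg) auto

lemma weight_diff_le:
  assumes S: "S \<subseteq> T" "finite T" and "qnorm_on T \<phi> \<le> 1" "qnorm_on T \<psi> \<le> 1"
  shows "(\<Sum>x\<in>S. (cmod (\<phi> x))\<^sup>2) \<le> (\<Sum>x\<in>S. (cmod (\<psi> x))\<^sup>2) + 2 * qnorm_on T (\<lambda>x. \<phi> x - \<psi> x)"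
proof -
  let ?a = "qnorm_on S \<phi>" and ?b = "qnorm_on S \<psi>" and ?d = "qnorm_on T (\<lambda>x. \<phi> x - \<psi> x)"
  have "?a = qnorm_on S (\<lambda>x. \<phi> x - (\<lambda>_. 0) x)" by simp
  also have "\<dots> \<le> qnorm_on S (\<lambda>x. \<phi> x - \<psi> x) + qnorm_on S (\<lambda>x. \<psi> x - (\<lambda>_. 0) x)"
    by (rule qnorm_on_triangle)
  also have "\<dots> \<le> ?d + ?b" using qnorm_on_subset[OF S, of "\<lambda>x. \<phi> x - \<psi> x"] by simp
  finally have ab: "?a \<le> ?d + ?b" .
  have a1: "?a \<le> 1" "?b \<le> 1" using assms qnorm_on_subset[OF S] by (meson order_trans)+
  have a0: "0 \<le> ?a" "0 \<le> ?b" "0 \<le> ?d" by auto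
  \<comment> \<open>The factor 2 of the claim is the bound on \<open>?a + ?b\<close> for vectors of
    norm at most 1.\<close>
  have "?a\<^sup>2 - ?b\<^sup>2 = (?a - ?b) * (?a + ?b)" by (simp add: power2_eq_square algebra_simps)
  also have "\<dots> \<le> ?d * 2"
    using ab a1 a0 by (intro mult_mono) auto
  finally show ?thesis unfolding qnorm_on_power2 by simp
qed

lemma sum_involution:
  assumes "\<And>x. x \<in> S \<Longrightarrow> h x \<in> S" "\<And>x. x \<in> S \<Longrightarrow> h (h x) = x"
  shows "(\<Sum>x\<in>S. F (h x)) = (\<Sum>x\<in>S. F x)"
  by (rule sum.reindex_bij_witness[of _ h h]) (use assms in auto)

section \<open>Circuits as linear isometries\<close>

definition wf_gate :: "nat \<Rightarrow> gate \<Rightarrow> bool" where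
  "wf_gate n g \<longleftrightarrow> distinct (gate_qubits g) \<and> set (gate_qubits g) \<subseteq> {..<n}"

lemma wf_circuit_iff: "wf_circuit n C \<longleftrightarrow> (\<forall>g\<in>set C. wf_gate n g)"
  unfolding wf_circuit_def wf_gate_def ..

lemma wf_gate_mono: "wf_gate n g \<Longrightarrow> n \<le> m \<Longrightarrow> wf_gate m g"
  unfolding wf_gate_def by auto

lemma wf_circuit_mono: "wf_circuit n C \<Longrightarrow> n \<le> m \<Longrightarrow> wf_circuit m C"
  unfolding wf_circuit_iff using wf_gate_mono by blast

lemma wf_circuit_Cons: "wf_circuit n (g # C) \<longleftrightarrow> wf_gate n g \<and> wf_circuit n C"
  unfolding wf_circuit_iff by auto

lemma wf_circuit_take: "wf_circuit n C \<Longrightarrow> wf_circuit n (take i C)"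
  unfolding wf_circuit_iff using in_set_takeD by fast

lemma map_nth_update_notin: "t \<notin> set qs \<Longrightarrow> map ((!) (x[t := b])) qs = map ((!) x) qs"
  by (auto intro!: map_cong nth_list_update_neq)

text \<open>Pair each \<open>x\<close> with its neighbour across bit \<open>i\<close>; on a pair,
  the claim is the parallelogram law. Summing over all \<open>x\<close> counts every pair
  twice.\<close>

lemma sum_apply_had:
  assumes i: "i < n"
  shows "(\<Sum>x\<in>bits n. (cmod (apply_gate A (Had i) \<psi> x))\<^sup>2) = (\<Sum>x\<in>bits n. (cmod (\<psi> x))\<^sup>2)"
proof -
  let ?h = "apply_gate A (Had i) \<psi>" and ?f = "\<lambda>x::bool list. x[i := \<not> x ! i]"
  have inv: "(\<Sum>x\<in>bits n. F (?f x)) = (\<Sum>x\<in>bits n. F x)" for F :: "bool list \<Rightarrow> real"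
    by (rule sum_involution) (use i in auto)
  have par: "(cmod ((a + b) / complex_of_real (sqrt 2)))\<^sup>2 + (cmod ((a - b) / complex_of_real (sqrt 2)))\<^sup>2
    = (cmod a)\<^sup>2 + (cmod b)\<^sup>2" for a b
    unfolding norm_divide power_divide cmod_power2 by (simp add: power2_eq_square field_simps)
  have pt: "(cmod (?h x))\<^sup>2 + (cmod (?h (?f x)))\<^sup>2 = (cmod (\<psi> x))\<^sup>2 + (cmod (\<psi> (?f x)))\<^sup>2"
    if "x \<in> bits n" for x
  proof (cases "x ! i")
    case True
    hence "x[i := True] = x" by (metis list_update_id)
    thus ?thesis using that i True par[of "\<psi> (x[i := False])" "\<psi> x"] by simp
  next
    case False
    hence "x[i := False] = x" by (metis list_update_id)
    thus ?thesis using that i False par[of "\<psi> x" "\<psi> (x[i := True])"] by simp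
  qed
  have "2 * (\<Sum>x\<in>bits n. (cmod (?h x))\<^sup>2) = (\<Sum>x\<in>bits n. (cmod (?h x))\<^sup>2 + (cmod (?h (?f x)))\<^sup>2)"
    unfolding sum.distrib inv[of "\<lambda>x. (cmod (?h x))\<^sup>2"] by simp
  also have "\<dots> = (\<Sum>x\<in>bits n. (cmod (\<psi> x))\<^sup>2 + (cmod (\<psi> (?f x)))\<^sup>2)"
    by (rule sum.cong[OF refl pt])
  also have "\<dots> = 2 * (\<Sum>x\<in>bits n. (cmod (\<psi> x))\<^sup>2)"
    unfolding sum.distrib inv[of "\<lambda>x. (cmod (\<psi> x))\<^sup>2"] by simp
  finally show ?thesis by simp
qed

text \<open>The restriction to \<open>P\<close> is meant for the event that the gate asks a given
  string: it does not depend on the target bit, so the gate preserves its weight.\<close>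

lemma sum_apply_query:
  assumes "wf_gate n (Query qs t)" "\<And>x b. P (x[t := b]) = P x"
  shows "(\<Sum>x\<in>{x \<in> bits n. P x}. (cmod (apply_gate A (Query qs t) \<psi> x))\<^sup>2) =
    (\<Sum>x\<in>{x \<in> bits n. P x}. (cmod (\<psi> x))\<^sup>2)"
proof -
  let ?h = "\<lambda>x. x[t := (x ! t \<noteq> (map ((!) x) qs \<in> A))]"
  have t: "t < n" "t \<notin> set qs" using assms by (auto simp: wf_gate_def)
  have "(\<Sum>x\<in>{x \<in> bits n. P x}. (cmod (\<psi> (?h x)))\<^sup>2) = (\<Sum>x\<in>{x \<in> bits n. P x}. (cmod (\<psi> x))\<^sup>2)"
  proof (rule sum_involution)
    fix x assume x: "x \<in> {x \<in> bits n. P x}"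
    thus "?h x \<in> {x \<in> bits n. P x}" using assms(2) by simp
    show "?h (?h x) = x"
      using x t by (cases "map ((!) x) qs \<in> A") (simp_all add: map_nth_update_notin)
  qed
  thus ?thesis by simp
qed

lemma sum_apply_gate:
  assumes "wf_gate n g"
  shows "(\<Sum>x\<in>bits n. (cmod (apply_gate A g \<psi> x))\<^sup>2) = (\<Sum>x\<in>bits n. (cmod (\<psi> x))\<^sup>2)"
proof (cases g)
  case (Had i)
  thus ?thesis using assms sum_apply_had[of i n] by (simp add: wf_gate_def)
next
  case (Phase i)
  thus ?thesis by (auto intro!: sum.cong simp: norm_mult)
next
  case (Toffoli i j k)
  let ?h = "\<lambda>x. x[k := (x ! k \<noteq> (x ! i \<and> x ! j))]"
  have k: "k < n" "i \<noteq> k" "j \<noteq> k" using assms Toffoli by (auto simp: wf_gate_def)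
  have "(\<Sum>x\<in>bits n. (cmod (\<psi> (?h x)))\<^sup>2) = (\<Sum>x\<in>bits n. (cmod (\<psi> x))\<^sup>2)"
  proof (rule sum_involution)
    fix x assume x: "x \<in> bits n"
    thus "?h x \<in> bits n" by simp
    show "?h (?h x) = x" using x k by (cases "x ! i \<and> x ! j") simp_all
  qed
  thus ?thesis using Toffoli by simp
next
  case (Query qs t)
  thus ?thesis using sum_apply_query[of n qs t "\<lambda>_. True" A \<psi>] assms by simp
qed

lemma qnorm_apply_gate:
  "wf_gate n g \<Longrightarrow> qnorm_on (bits n) (apply_gate A g \<psi>) = qnorm_on (bits n) \<psi>"
  unfolding L2_set_def using sum_apply_gate by simp

lemma apply_circuit_Nil [simp]: "apply_circuit A [] \<psi> = \<psi>"
  by (simp add: apply_circuit_def)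

lemma apply_circuit_Cons [simp]:
  "apply_circuit A (g # C) \<psi> = apply_circuit A C (apply_gate A g \<psi>)"
  by (simp add: apply_circuit_def)

lemma qnorm_apply_circuit:
  "wf_circuit n C \<Longrightarrow> qnorm_on (bits n) (apply_circuit A C \<psi>) = qnorm_on (bits n) \<psi>"
  by (induction C arbitrary: \<psi>) (auto simp: wf_circuit_Cons qnorm_apply_gate)

lemma apply_gate_diff:
  "apply_gate A g (\<lambda>x. \<phi> x - \<psi> x) = (\<lambda>x. apply_gate A g \<phi> x - apply_gate A g \<psi> x)"
  by (cases g) (auto simp: algebra_simps diff_divide_distrib add_divide_distrib)

lemma apply_circuit_diff:
  "apply_circuit A C (\<lambda>x. \<phi> x - \<psi> x) = (\<lambda>x. apply_circuit A C \<phi> x - apply_circuit A C \<psi> x)"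
  by (induction C arbitrary: \<phi> \<psi>) (auto simp: apply_gate_diff)

lemma apply_gate_sum:
  "apply_gate A g (\<lambda>x. \<Sum>i\<in>I. c i * \<phi> i x) = (\<lambda>x. \<Sum>i\<in>I. c i * apply_gate A g (\<phi> i) x)"
proof (cases g)
  case (Had i)
  show ?thesis
    unfolding Had apply_gate.simps sum_distrib_left sum.distrib[symmetric] sum_divide_distrib
    by (intro ext sum.cong refl) (simp add: ring_distribs)
qed (auto simp: sum_distrib_left algebra_simps intro!: sum.cong)

lemma apply_circuit_sum:
  "apply_circuit A C (\<lambda>x. \<Sum>i\<in>I. c i * \<phi> i x) = (\<lambda>x. \<Sum>i\<in>I. c i * apply_circuit A C (\<phi> i) x)"
  by (induction C arbitrary: \<phi>) (auto simp: apply_gate_sum)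

lemma apply_gate_local:
  assumes "\<And>x. x \<in> bits n \<Longrightarrow> \<phi> x = \<psi> x" "x \<in> bits n"
  shows "apply_gate A g \<phi> x = apply_gate A g \<psi> x"
  using assms by (cases g) auto

lemma apply_circuit_local:
  assumes "\<And>x. x \<in> bits n \<Longrightarrow> \<phi> x = \<psi> x" "x \<in> bits n"
  shows "apply_circuit A C \<phi> x = apply_circuit A C \<psi> x"
  using assms
proof (induction C arbitrary: \<phi> \<psi> x)
  case (Cons g C)
  show ?case unfolding apply_circuit_Cons
    by (rule Cons.IH[OF apply_gate_local[OF Cons.prems(1)] Cons.prems(2)])
qed simp

text \<open>A gate on the first \<open>k\<close> qubits is of the form U tensor identity: each slice
  with fixed trailing bits \<open>z\<close> evolves on its own. This links runs on a large state to
  its reduced state.\<close>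

lemma apply_gate_slice:
  assumes "wf_gate k g" "x \<in> bits k"
  shows "apply_gate A g \<psi> (x @ z) = apply_gate A g (\<lambda>y. \<psi> (y @ z)) x"
proof -
  have q: "i < length x" if "i \<in> set (gate_qubits g)" for i
    using assms that by (auto simp: wf_gate_def)
  show ?thesis
  proof (cases g)
    case (Query qs t)
    have m: "map ((!) (x @ z)) qs = map ((!) x) qs"
      using q Query by (intro map_cong) (auto simp: nth_append)
    show ?thesis
      unfolding Query apply_gate.simps m using q Query by (simp add: nth_append list_update_append1)
  qed (use q in \<open>simp_all add: nth_append list_update_append1\<close>)
qed

lemma apply_circuit_slice:
  assumes "wf_circuit k C" "x \<in> bits k"
  shows "apply_circuit A C \<psi> (x @ z) = apply_circuit A C (\<lambda>y. \<psi> (y @ z)) x"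
  using assms
proof (induction C arbitrary: \<psi> x)
  case (Cons g C)
  have "apply_circuit A (g # C) \<psi> (x @ z) = apply_circuit A C (\<lambda>y. apply_gate A g \<psi> (y @ z)) x"
    using Cons.IH[of x "apply_gate A g \<psi>"] Cons.prems by (simp add: wf_circuit_Cons)
  also have "\<dots> = apply_circuit A C (apply_gate A g (\<lambda>y. \<psi> (y @ z))) x"
    by (rule apply_circuit_local[where n = k])
      (use apply_gate_slice Cons.prems in \<open>auto simp: wf_circuit_Cons\<close>)
  finally show ?case by simp
qed simp

section \<open>Query weights and replacement of the oracle\<close>

fun asks :: "gate \<Rightarrow> bool list \<Rightarrow> bool list \<Rightarrow> bool" where
  "asks (Query qs t) u x \<longleftrightarrow> map ((!) x) qs = u"
| "asks _ u x \<longleftrightarrow> False"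

text \<open>The query magnitude of \<open>u\<close> in the standard hybrid argument: the probability
  that measuring just before \<open>g\<close> would show the query \<open>u\<close>, for a
  normalized state.\<close>

definition query_weight :: "nat \<Rightarrow> bool list \<Rightarrow> gate \<Rightarrow> qstate \<Rightarrow> real" where
  "query_weight n u g \<psi> = (\<Sum>x\<in>{x \<in> bits n. asks g u x}. (cmod (\<psi> x))\<^sup>2)"

lemma query_weight_nonneg: "0 \<le> query_weight n u g \<psi>"
  unfolding query_weight_def by (intro sum_nonneg) auto

text \<open>In one basis state, a gate asks at most one string, so different \<open>u\<close> use
  disjoint sets of basis states.\<close>

lemma sum_query_weight_le:
  assumes "finite U"
  shows "(\<Sum>u\<in>U. query_weight n u g \<psi>) \<le> (qnorm_on (bits n) \<psi>)\<^sup>2"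
proof -
  have uniq: "u = v" if "asks g u x" "asks g v x" for u v x
    using that by (cases g) auto
  have "(\<Sum>u\<in>U. query_weight n u g \<psi>) =
    (\<Sum>u\<in>U. \<Sum>x\<in>bits n. if asks g u x then (cmod (\<psi> x))\<^sup>2 else 0)"
    unfolding query_weight_def sum.inter_filter[OF finite_bits] ..
  also have "\<dots> = (\<Sum>x\<in>bits n. \<Sum>u\<in>U. if asks g u x then (cmod (\<psi> x))\<^sup>2 else 0)"
    by (rule sum.swap)
  also have "\<dots> \<le> (\<Sum>x\<in>bits n. (cmod (\<psi> x))\<^sup>2)"
  proof (rule sum_mono)
    fix x
    show "(\<Sum>u\<in>U. if asks g u x then (cmod (\<psi> x))\<^sup>2 else 0) \<le> (cmod (\<psi> x))\<^sup>2"
    proof (cases "\<exists>v\<in>U. asks g v x")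
      case True
      then obtain v where v: "v \<in> U" "asks g v x" by blast
      have "(\<Sum>u\<in>U. if asks g u x then (cmod (\<psi> x))\<^sup>2 else 0) =
        (\<Sum>u\<in>U. if u = v then (cmod (\<psi> x))\<^sup>2 else 0)"
        using v uniq by (intro sum.cong) auto
      thus ?thesis using v assms by simp
    next
      case False
      hence "(\<Sum>u\<in>U. if asks g u x then (cmod (\<psi> x))\<^sup>2 else 0) = 0"
        by (intro sum.neutral) auto
      thus ?thesis by simp
    qed
  qed
  finally show ?thesis unfolding qnorm_on_power2 .
qed

text \<open>The two results agree except on basis states that ask \<open>u\<close>, and there each
  has norm equal to the square root of the query weight; the triangle inequality gives the factor
  2.\<close>

lemma gate_hybrid:
  assumes wf: "wf_gate n g" and AB: "\<And>s. s \<noteq> u \<Longrightarrow> s \<in> A \<longleftrightarrow> s \<in> B"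
  shows "qnorm_on (bits n) (\<lambda>x. apply_gate A g \<psi> x - apply_gate B g \<psi> x)
    \<le> 2 * sqrt (query_weight n u g \<psi>)"
proof (cases g)
  case (Query qs t)
  let ?S = "{x \<in> bits n. asks g u x}"
  have t: "t \<notin> set qs" using wf Query by (auto simp: wf_gate_def)
  have z: "apply_gate A g \<psi> x - apply_gate B g \<psi> x = 0" if "x \<in> bits n - ?S" for x
    using that AB[of "map ((!) x) qs"] unfolding Query by auto
  have "qnorm_on (bits n) (\<lambda>x. apply_gate A g \<psi> x - apply_gate B g \<psi> x) =
    qnorm_on ?S (\<lambda>x. apply_gate A g \<psi> x - apply_gate B g \<psi> x)"
    unfolding L2_set_def
    by (rule arg_cong[where f = sqrt], rule sum.mono_neutral_right) (use z in auto)
  also have "\<dots> \<le> qnorm_on ?S (apply_gate A g \<psi>) + qnorm_on ?S (apply_gate B g \<psi>)"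
    by (rule qnorm_on_diff_le)
  also have "\<dots> = 2 * sqrt (query_weight n u g \<psi>)"
  proof -
    have "qnorm_on ?S (apply_gate D g \<psi>) = sqrt (query_weight n u g \<psi>)" for D
      unfolding L2_set_def query_weight_def Query
      by (rule arg_cong[where f = sqrt], rule sum_apply_query)
        (use wf Query t in \<open>auto simp: map_nth_update_notin\<close>)
    thus ?thesis by simp
  qed
  finally show ?thesis .
qed (simp_all add: query_weight_def L2_set_def)

text \<open>Hybrids use \<open>B\<close> on a prefix and \<open>A\<close> on the rest; the common
  suffix is an isometry, so the errors of the single gates add up. The weights on the right come
  from the run with \<open>B\<close> alone, so they can be bounded before the differing string is
  known.\<close>

lemma circuit_hybrid:
  assumes "wf_circuit n C" and AB: "\<And>s. s \<noteq> u \<Longrightarrow> s \<in> A \<longleftrightarrow> s \<in> B"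
  shows "qnorm_on (bits n) (\<lambda>x. apply_circuit A C \<psi> x - apply_circuit B C \<psi> x)
    \<le> (\<Sum>i<length C. 2 * sqrt (query_weight n u (C ! i) (apply_circuit B (take i C) \<psi>)))"
  using assms(1)
proof (induction C arbitrary: \<psi>)
  case (Cons g C)
  hence wf: "wf_gate n g" "wf_circuit n C" by (auto simp: wf_circuit_Cons)
  let ?a = "apply_gate A g \<psi>" and ?b = "apply_gate B g \<psi>"
  have "qnorm_on (bits n) (\<lambda>x. apply_circuit A C ?a x - apply_circuit B C ?b x) \<le>
    qnorm_on (bits n) (\<lambda>x. apply_circuit A C ?a x - apply_circuit A C ?b x) +
    qnorm_on (bits n) (\<lambda>x. apply_circuit A C ?b x - apply_circuit B C ?b x)"
    by (rule qnorm_on_triangle)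
  also have "qnorm_on (bits n) (\<lambda>x. apply_circuit A C ?a x - apply_circuit A C ?b x) =
    qnorm_on (bits n) (\<lambda>x. ?a x - ?b x)"
    using qnorm_apply_circuit[OF wf(2), of A "\<lambda>x. ?a x - ?b x"] unfolding apply_circuit_diff .
  also have "qnorm_on (bits n) (\<lambda>x. ?a x - ?b x) +
      qnorm_on (bits n) (\<lambda>x. apply_circuit A C ?b x - apply_circuit B C ?b x) \<le>
      2 * sqrt (query_weight n u g \<psi>) +
      (\<Sum>i<length C. 2 * sqrt (query_weight n u (C ! i) (apply_circuit B (take i C) ?b)))"
    by (intro add_mono gate_hybrid[OF wf(1) AB] Cons.IH[OF wf(2)])
  also have "\<dots> = (\<Sum>i<length (g # C).
      2 * sqrt (query_weight n u ((g # C) ! i) (apply_circuit B (take i (g # C)) \<psi>)))"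
    by (simp add: sum.lessThan_Suc_shift del: sum.lessThan_Suc)
  finally show ?case by simp
qed (simp add: L2_set_def)

section \<open>Measurement weights as functions of reduced states\<close>

lemma sum_bits_append:
  "(\<Sum>x\<in>bits (k + m). F x) = (\<Sum>z\<in>bits m. \<Sum>x\<in>bits k. F (x @ z))"
proof -
  have "(\<Sum>x\<in>bits (k + m). F x) = (\<Sum>p\<in>bits m \<times> bits k. F (snd p @ fst p))"
    by (rule sum.reindex_bij_witness[of _ "\<lambda>p. snd p @ fst p" "\<lambda>x. (drop k x, take k x)"]) auto
  thus ?thesis by (simp add: sum.cartesian_product split_def)
qed

lemma basis_bij: "bij_betw (basis k) {..<2 ^ k} (bits k)"
proof -
  have "distinct (List.n_lists k [False, True])" by (simp add: distinct_n_lists)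
  moreover have "length (List.n_lists k [False, True]) = 2 ^ k" by (simp add: length_n_lists numeral_2_eq_2)
  moreover have "set (List.n_lists k [False, True]) = bits k"
    by (auto simp: set_n_lists)
  ultimately show ?thesis
    using bij_betw_nth[of "List.n_lists k [False, True]" "{..<2 ^ k}" "bits k"]
    unfolding basis_def[abs_def] by simp
qed

definition indicator_state :: "bool list \<Rightarrow> qstate" where
  "indicator_state y = (\<lambda>x. if x = y then 1 else 0)"

text \<open>Coefficients of the quadratic form mapping \<open>\<psi>\<close> to the squared norm of the part of \<open>C \<psi>\<close> on \<open>P\<close>.\<close>

definition form_coeff :: "nat \<Rightarrow> bool list set \<Rightarrow> circuit \<Rightarrow> (bool list \<Rightarrow> bool) \<Rightarrow> nat \<Rightarrow> nat \<Rightarrow> complex" where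
  "form_coeff k A C P b a = (\<Sum>x\<in>{x \<in> bits k. P x}.
     apply_circuit A C (indicator_state (basis k a)) x *
     cnj (apply_circuit A C (indicator_state (basis k b)) x))"

lemma projection_weight_form:
  "complex_of_real (\<Sum>x\<in>{x \<in> bits k. P x}. (cmod (apply_circuit A C \<psi> x))\<^sup>2) =
    (\<Sum>a<2 ^ k. \<Sum>b<2 ^ k. form_coeff k A C P b a * (\<psi> (basis k a) * cnj (\<psi> (basis k b))))"
proof -
  let ?e = "\<lambda>a. apply_circuit A C (indicator_state (basis k a))"
  have ex: "apply_circuit A C \<psi> x = (\<Sum>a<2 ^ k. \<psi> (basis k a) * ?e a x)" if "x \<in> bits k" for x
  proof -
    have "\<psi> y = (\<Sum>a<2 ^ k. \<psi> (basis k a) * indicator_state (basis k a) y)" if "y \<in> bits k" for y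
    proof -
      have "(\<Sum>a<2 ^ k. \<psi> (basis k a) * indicator_state (basis k a) y) =
        (\<Sum>w\<in>bits k. \<psi> w * indicator_state w y)"
        by (rule sum.reindex_bij_betw[OF basis_bij])
      also have "\<dots> = (\<Sum>w\<in>bits k. if w = y then \<psi> y else 0)"
        by (intro sum.cong) (auto simp: indicator_state_def)
      finally show ?thesis using that by simp
    qed
    hence "apply_circuit A C \<psi> x =
      apply_circuit A C (\<lambda>y. \<Sum>a<2 ^ k. \<psi> (basis k a) * indicator_state (basis k a) y) x"
      using \<open>x \<in> bits k\<close> by (intro apply_circuit_local[where n = k]) auto
    thus ?thesis unfolding apply_circuit_sum .
  qed
  have "complex_of_real (\<Sum>x\<in>{x \<in> bits k. P x}. (cmod (apply_circuit A C \<psi> x))\<^sup>2) =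
    (\<Sum>x\<in>{x \<in> bits k. P x}. (\<Sum>a<2 ^ k. \<psi> (basis k a) * ?e a x) *
       cnj (\<Sum>b<2 ^ k. \<psi> (basis k b) * ?e b x))"
    unfolding of_real_sum complex_norm_square by (intro sum.cong) (auto simp: ex)
  also have "\<dots> = (\<Sum>x\<in>{x \<in> bits k. P x}. \<Sum>a<2 ^ k. \<Sum>b<2 ^ k.
       (?e a x * cnj (?e b x)) * (\<psi> (basis k a) * cnj (\<psi> (basis k b))))"
    by (simp add: sum_product mult_ac)
  also have "\<dots> = (\<Sum>a<2 ^ k. \<Sum>x\<in>{x \<in> bits k. P x}. \<Sum>b<2 ^ k.
       (?e a x * cnj (?e b x)) * (\<psi> (basis k a) * cnj (\<psi> (basis k b))))"
    by (rule sum.swap)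
  also have "\<dots> = (\<Sum>a<2 ^ k. \<Sum>b<2 ^ k. \<Sum>x\<in>{x \<in> bits k. P x}.
       (?e a x * cnj (?e b x)) * (\<psi> (basis k a) * cnj (\<psi> (basis k b))))"
    by (intro sum.cong refl sum.swap)
  finally show ?thesis unfolding form_coeff_def sum_distrib_right .
qed

text \<open>Both \<open>C\<close> and \<open>P\<close> concern only the first \<open>k\<close>
  qubits, so the weight is a sum over the slices \<open>z\<close> of the same form, and summing the
  products of amplitudes over \<open>z\<close> is the partial trace.\<close>

lemma projection_weight_reduced:
  assumes wf: "wf_circuit k C" and P: "\<And>x z. x \<in> bits k \<Longrightarrow> P (x @ z) = P x"
  shows "complex_of_real (\<Sum>x\<in>{x \<in> bits (k + m). P x}. (cmod (apply_circuit A C \<psi> x))\<^sup>2) =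
    (\<Sum>a<2 ^ k. \<Sum>b<2 ^ k. form_coeff k A C P b a * reduced_state k (k + m) \<psi> $$ (a, b))"
proof -
  have "(\<Sum>x\<in>{x \<in> bits (k + m). P x}. (cmod (apply_circuit A C \<psi> x))\<^sup>2) =
    (\<Sum>x\<in>bits (k + m). if P x then (cmod (apply_circuit A C \<psi> x))\<^sup>2 else 0)"
    unfolding sum.inter_filter[OF finite_bits] ..
  also have "\<dots> = (\<Sum>z\<in>bits m. \<Sum>x\<in>bits k. if P x then (cmod (apply_circuit A C (\<lambda>y. \<psi> (y @ z)) x))\<^sup>2 else 0)"
    unfolding sum_bits_append by (intro sum.cong refl) (auto simp: P apply_circuit_slice[OF wf])
  also have "\<dots> = (\<Sum>z\<in>bits m. \<Sum>x\<in>{x \<in> bits k. P x}. (cmod (apply_circuit A C (\<lambda>y. \<psi> (y @ z)) x))\<^sup>2)"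
    unfolding sum.inter_filter[OF finite_bits] ..
  finally have "complex_of_real (\<Sum>x\<in>{x \<in> bits (k + m). P x}. (cmod (apply_circuit A C \<psi> x))\<^sup>2) =
    (\<Sum>z\<in>bits m. complex_of_real (\<Sum>x\<in>{x \<in> bits k. P x}. (cmod (apply_circuit A C (\<lambda>y. \<psi> (y @ z)) x))\<^sup>2))"
    by (simp only: of_real_sum)
  also have "\<dots> = (\<Sum>z\<in>bits m. \<Sum>a<2 ^ k. \<Sum>b<2 ^ k. form_coeff k A C P b a *
      (\<psi> (basis k a @ z) * cnj (\<psi> (basis k b @ z))))"
    unfolding projection_weight_form ..
  also have "\<dots> = (\<Sum>a<2 ^ k. \<Sum>z\<in>bits m. \<Sum>b<2 ^ k. form_coeff k A C P b a *
      (\<psi> (basis k a @ z) * cnj (\<psi> (basis k b @ z))))"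
    by (rule sum.swap)
  also have "\<dots> = (\<Sum>a<2 ^ k. \<Sum>b<2 ^ k. \<Sum>z\<in>bits m. form_coeff k A C P b a *
      (\<psi> (basis k a @ z) * cnj (\<psi> (basis k b @ z))))"
    by (intro sum.cong refl sum.swap)
  also have "\<dots> = (\<Sum>a<2 ^ k. \<Sum>b<2 ^ k. form_coeff k A C P b a * reduced_state k (k + m) \<psi> $$ (a, b))"
    by (intro sum.cong refl) (auto simp: reduced_state_def sum_distrib_left)
  finally show ?thesis .
qed

lemma reduced_state_carrier [simp]: "reduced_state k n \<psi> \<in> carrier_mat (2 ^ k) (2 ^ k)"
  unfolding reduced_state_def by simp

lemma reduced_state_diff_hermitian:
  "mat_adjoint (reduced_state k n \<psi> - reduced_state k n' \<phi>) = reduced_state k n \<psi> - reduced_state k n' \<phi>"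
    (is "mat_adjoint ?X = ?X")
proof (rule eq_matI)
  have X: "?X \<in> carrier_mat (2 ^ k) (2 ^ k)" by (rule minus_carrier_mat) simp
  fix i j assume "i < dim_row ?X" "j < dim_col ?X"
  hence ij: "i < 2 ^ k" "j < 2 ^ k" using X by auto
  show "mat_adjoint ?X $$ (i, j) = ?X $$ (i, j)"
    unfolding mat_adjoint_index[OF X ij] using ij by (simp add: reduced_state_def mult.commute)
qed (auto simp: reduced_state_def)

text \<open>The matrix \<open>form_coeff\<close> is C* Pi C for the projection Pi given by
  \<open>P\<close>, so its form lies between 0 and the squared norm and trace norm duality applies.
  The numbers \<open>m\<close> and \<open>m'\<close> are separate because a simulator's ancillas and
  a prover's private qubits differ in number.\<close>

lemma projection_weight_trace_norm:
  assumes wf: "wf_circuit k C" and P: "\<And>x z. x \<in> bits k \<Longrightarrow> P (x @ z) = P x"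
  shows "\<bar>(\<Sum>x\<in>{x \<in> bits (k + m). P x}. (cmod (apply_circuit A C \<phi> x))\<^sup>2) -
      (\<Sum>x\<in>{x \<in> bits (k + m'). P x}. (cmod (apply_circuit A C \<psi> x))\<^sup>2)\<bar>
    \<le> trace_norm (reduced_state k (k + m) \<phi> - reduced_state k (k + m') \<psi>)"
proof -
  let ?E = "form_coeff k A C P" and ?r = "reduced_state k (k + m) \<phi>" and ?s = "reduced_state k (k + m') \<psi>"
  let ?X = "?r - ?s"
  have X: "?X \<in> carrier_mat (2 ^ k) (2 ^ k)" by (rule minus_carrier_mat) simp
  have bound: "cmod (\<Sum>a<2 ^ k. \<Sum>b<2 ^ k. ?E b a * (v a * cnj (v b))) \<le> (\<Sum>a<2 ^ k. (cmod (v a))\<^sup>2)"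
    for v
  proof -
    \<comment> \<open>A vector on indices is turned back into a state, so that its form is the
      weight of an actual run.\<close>
    define \<chi> where "\<chi> y = v (the_inv_into {..<2 ^ k} (basis k) y)" for y
    have \<chi>: "\<chi> (basis k a) = v a" if "a < 2 ^ k" for a
      unfolding \<chi>_def using that basis_bij[of k]
      by (subst the_inv_into_f_f) (auto simp: bij_betw_def)
    have "(\<Sum>a<2 ^ k. \<Sum>b<2 ^ k. ?E b a * (v a * cnj (v b))) =
      complex_of_real (\<Sum>x\<in>{x \<in> bits k. P x}. (cmod (apply_circuit A C \<chi> x))\<^sup>2)"
      unfolding projection_weight_form by (intro sum.cong refl) (auto simp: \<chi>)
    also have "cmod \<dots> = (\<Sum>x\<in>{x \<in> bits k. P x}. (cmod (apply_circuit A C \<chi> x))\<^sup>2)"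
      unfolding norm_of_real by (intro abs_of_nonneg sum_nonneg) auto
    also have "\<dots> \<le> (\<Sum>x\<in>bits k. (cmod (apply_circuit A C \<chi> x))\<^sup>2)"
      by (intro sum_mono2) auto
    also have "\<dots> = (\<Sum>x\<in>bits k. (cmod (\<chi> x))\<^sup>2)"
      unfolding qnorm_on_power2[symmetric] qnorm_apply_circuit[OF wf] ..
    also have "\<dots> = (\<Sum>a<2 ^ k. (cmod (\<chi> (basis k a)))\<^sup>2)"
      by (rule sum.reindex_bij_betw[OF basis_bij, symmetric])
    also have "\<dots> = (\<Sum>a<2 ^ k. (cmod (v a))\<^sup>2)"
      by (intro sum.cong) (auto simp: \<chi>)
    finally show ?thesis .
  qed
  have "complex_of_real ((\<Sum>x\<in>{x \<in> bits (k + m). P x}. (cmod (apply_circuit A C \<phi> x))\<^sup>2) -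
      (\<Sum>x\<in>{x \<in> bits (k + m'). P x}. (cmod (apply_circuit A C \<psi> x))\<^sup>2)) =
      (\<Sum>a<2 ^ k. \<Sum>b<2 ^ k. ?E b a * ?r $$ (a, b)) - (\<Sum>a<2 ^ k. \<Sum>b<2 ^ k. ?E b a * ?s $$ (a, b))"
    unfolding of_real_diff by (intro arg_cong2[where f = "(-)"] projection_weight_reduced[OF wf] P)
  also have "\<dots> = (\<Sum>a<2 ^ k. \<Sum>b<2 ^ k. ?E b a * ?X $$ (a, b))"
    unfolding sum_subtractf[symmetric]
    by (intro sum.cong refl) (auto simp: reduced_state_def algebra_simps)
  finally have eq: "complex_of_real ((\<Sum>x\<in>{x \<in> bits (k + m). P x}. (cmod (apply_circuit A C \<phi> x))\<^sup>2) -
      (\<Sum>x\<in>{x \<in> bits (k + m'). P x}. (cmod (apply_circuit A C \<psi> x))\<^sup>2)) =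
      (\<Sum>a<2 ^ k. \<Sum>b<2 ^ k. ?E b a * ?X $$ (a, b))" .
  show ?thesis
    using trace_norm_ge_quadratic_form[where E = ?E, OF X reduced_state_diff_hermitian bound]
    unfolding arg_cong[OF eq, of cmod, symmetric] norm_of_real .
qed

lemma asks_append:
  assumes "wf_gate k g" "x \<in> bits k"
  shows "asks g u (x @ z) = asks g u x"
proof (cases g)
  case (Query qs t)
  hence m: "map ((!) (x @ z)) qs = map ((!) x) qs"
    using assms by (auto simp: wf_gate_def nth_append)
  show ?thesis unfolding Query asks.simps m ..
qed auto

lemma query_weight_trace_norm:
  assumes "wf_circuit k C" "wf_gate k g"
  shows "\<bar>query_weight (k + m) u g (apply_circuit A C \<phi>) - query_weight (k + m') u g (apply_circuit A C \<psi>)\<bar>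
    \<le> trace_norm (reduced_state k (k + m) \<phi> - reduced_state k (k + m') \<psi>)"
  unfolding query_weight_def
  by (rule projection_weight_trace_norm[OF assms(1)], rule asks_append[OF assms(2)])

section \<open>The prover's operations as isometries\<close>

lemma apply_last_diff:
  "apply_last v n U (\<lambda>x. \<phi> x - \<psi> x) = (\<lambda>x. apply_last v n U \<phi> x - apply_last v n U \<psi> x)"
  unfolding apply_last_def by (simp add: algebra_simps sum_subtractf)

lemma sum_unitary_op:
  assumes "unitary_op n U"
  shows "(\<Sum>z\<in>bits n. (cmod (\<Sum>y\<in>bits n. U z y * f y))\<^sup>2) = (\<Sum>y\<in>bits n. (cmod (f y))\<^sup>2)"
proof -
  have "complex_of_real (\<Sum>z\<in>bits n. (cmod (\<Sum>y\<in>bits n. U z y * f y))\<^sup>2) =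
    (\<Sum>z\<in>bits n. \<Sum>y\<in>bits n. \<Sum>x\<in>bits n. (cnj (U z x) * U z y) * (f y * cnj (f x)))"
    unfolding of_real_sum complex_norm_square by (simp add: sum_product mult_ac)
  also have "\<dots> = (\<Sum>y\<in>bits n. \<Sum>z\<in>bits n. \<Sum>x\<in>bits n. (cnj (U z x) * U z y) * (f y * cnj (f x)))"
    by (rule sum.swap)
  also have "\<dots> = (\<Sum>y\<in>bits n. \<Sum>x\<in>bits n. \<Sum>z\<in>bits n. (cnj (U z x) * U z y) * (f y * cnj (f x)))"
    by (intro sum.cong refl sum.swap)
  also have "\<dots> = (\<Sum>y\<in>bits n. \<Sum>x\<in>bits n. (if x = y then 1 else 0) * (f y * cnj (f x)))"
    using assms unfolding unitary_op_def
    by (intro sum.cong refl) (simp add: sum_distrib_right[symmetric])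
  also have "\<dots> = (\<Sum>y\<in>bits n. \<Sum>x\<in>bits n. if x = y then f y * cnj (f y) else 0)"
    by (intro sum.cong refl) auto
  also have "\<dots> = (\<Sum>y\<in>bits n. f y * cnj (f y))"
    by (intro sum.cong refl) simp
  also have "\<dots> = complex_of_real (\<Sum>y\<in>bits n. (cmod (f y))\<^sup>2)"
    unfolding of_real_sum complex_norm_square ..
  finally show ?thesis using of_real_eq_iff by blast
qed

lemma qnorm_apply_last:
  assumes "unitary_op n U"
  shows "qnorm_on (bits (v + n)) (apply_last v n U \<psi>) = qnorm_on (bits (v + n)) \<psi>"
proof -
  have "(\<Sum>x\<in>bits (v + n). (cmod (apply_last v n U \<psi> x))\<^sup>2) =
    (\<Sum>a\<in>bits v. \<Sum>z\<in>bits n. (cmod (\<Sum>y\<in>bits n. U z y * \<psi> (a @ y)))\<^sup>2)"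
    unfolding sum_bits_append
    by (subst sum.swap) (auto simp: apply_last_def intro!: sum.cong)
  also have "\<dots> = (\<Sum>a\<in>bits v. \<Sum>z\<in>bits n. (cmod (\<psi> (a @ z)))\<^sup>2)"
    unfolding sum_unitary_op[OF assms] ..
  also have "\<dots> = (\<Sum>x\<in>bits (v + n). (cmod (\<psi> x))\<^sup>2)"
    unfolding sum_bits_append by (rule sum.swap)
  finally show ?thesis unfolding L2_set_def by simp
qed

lemma qnorm_zero_state: "qnorm_on (bits n) (zero_state n) = 1"
proof -
  have "(\<Sum>x\<in>bits n. (cmod (zero_state n x))\<^sup>2) = (\<Sum>x\<in>bits n. if x = replicate n False then 1 else 0)"
    unfolding zero_state_def by (intro sum.cong) auto
  thus ?thesis unfolding L2_set_def by simp
qed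

subsection \<open>Violating completeness, soundness or zero knowledge\<close>

lemma wf_verifier_circuit:
  assumes "wf_verifier V" "k < length (circuits V)"
  shows "wf_circuit (priv V + msg V) (circuits V ! k)"
  using assms unfolding wf_verifier_def by auto

lemma num_messages_div_less:
  assumes "wf_verifier V" "j \<le> num_messages V"
  shows "j div 2 < length (circuits V)"
  using assms unfolding wf_verifier_def num_messages_def by (cases "circuits V") auto

lemma qnorm_joint_state:
  assumes V: "wf_verifier V" and P: "is_prover V p P" and "j \<le> Suc (num_messages V)"
  shows "qnorm_on (bits (priv V + msg V + p)) (joint_state A V p P j) = 1"
  using assms(3)
proof (induction j)
  case 0
  show ?case using qnorm_zero_state[of "priv V + msg V + p"] by simp
next
  case (Suc j)
  let ?n = "priv V + msg V + p"
  have IH: "qnorm_on (bits ?n) (joint_state A V p P j) = 1" using Suc by simp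
  show ?case
  proof (cases "even j")
    case True
    have "wf_circuit ?n (circuits V ! (j div 2))"
      using wf_circuit_mono[OF wf_verifier_circuit[OF V num_messages_div_less[OF V]]] Suc.prems by simp
    from qnorm_apply_circuit[OF this, of A "joint_state A V p P j"] show ?thesis using True IH by simp
  next
    case False
    have "unitary_op (msg V + p) (P (j div 2))" using P unfolding is_prover_def by blast
    from qnorm_apply_last[OF this, of "priv V" "joint_state A V p P j"]
    show ?thesis using False IH by (simp add: add.assoc)
  qed
qed

text \<open>Both runs use the same prover, whose unitaries preserve the distance. At a verifier
  circuit, the state of the \<open>A\<close>-run is kept while the oracle changes from
  \<open>A\<close> to \<open>B\<close> and from \<open>B\<close> to \<open>A'\<close>, each costing
  twice the number of gates times \<open>sqrt \<eta>\<close>; then the input state changes under an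
  isometry. So weights are required only along the \<open>A\<close>-run. The number
  \<open>Suc j div 2\<close> counts the verifier circuits among the first \<open>j\<close>
  operations.\<close>

lemma interaction_hybrid:
  assumes V: "wf_verifier V" and P: "is_prover V p P"
    and A: "\<And>s. s \<noteq> w \<Longrightarrow> s \<in> A \<longleftrightarrow> s \<in> B" and A': "\<And>s. s \<noteq> w' \<Longrightarrow> s \<in> A' \<longleftrightarrow> s \<in> B"
    and weight: "\<And>k i u. k < length (circuits V) \<Longrightarrow> i < length (circuits V ! k) \<Longrightarrow> u = w \<or> u = w' \<Longrightarrow>
      query_weight (priv V + msg V + p) u (circuits V ! k ! i)
        (apply_circuit B (take i (circuits V ! k)) (joint_state A V p P (2 * k))) \<le> \<eta>"
    and j: "j \<le> Suc (num_messages V)"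
  shows "qnorm_on (bits (priv V + msg V + p)) (\<lambda>x. joint_state A V p P j x - joint_state A' V p P j x)
    \<le> (\<Sum>k<Suc j div 2. 4 * real (length (circuits V ! k)) * sqrt \<eta>)"
  using j
proof (induction j)
  case 0
  show ?case by (simp add: L2_set_def)
next
  case (Suc j)
  let ?n = "priv V + msg V + p"
  let ?\<phi> = "joint_state A V p P j" and ?\<psi> = "joint_state A' V p P j"
  let ?d = "\<lambda>x. ?\<phi> x - ?\<psi> x"
  have IH: "qnorm_on (bits ?n) ?d \<le> (\<Sum>k<Suc j div 2. 4 * real (length (circuits V ! k)) * sqrt \<eta>)"
    using Suc by simp
  show ?case
  proof (cases "even j")
    case True
    then obtain k where k: "j = 2 * k" by blast
    have kl: "k < length (circuits V)" using num_messages_div_less[OF V, of j] Suc.prems k by simp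
    let ?C = "circuits V ! k"
    have wf: "wf_circuit ?n ?C" using wf_circuit_mono[OF wf_verifier_circuit[OF V kl]] by simp
    have hyb: "qnorm_on (bits ?n) (\<lambda>x. apply_circuit D ?C ?\<phi> x - apply_circuit B ?C ?\<phi> x)
      \<le> 2 * real (length ?C) * sqrt \<eta>"
      if D: "\<And>s. s \<noteq> u \<Longrightarrow> s \<in> D \<longleftrightarrow> s \<in> B" and u: "u = w \<or> u = w'" for D u
    proof -
      have "qnorm_on (bits ?n) (\<lambda>x. apply_circuit D ?C ?\<phi> x - apply_circuit B ?C ?\<phi> x)
        \<le> (\<Sum>i<length ?C. 2 * sqrt (query_weight ?n u (?C ! i) (apply_circuit B (take i ?C) ?\<phi>)))"
        by (rule circuit_hybrid[OF wf]) (rule D)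
      also have "\<dots> \<le> (\<Sum>i<length ?C. 2 * sqrt \<eta>)"
        using weight[OF kl _ u] k by (intro sum_mono mult_left_mono) auto
      finally show ?thesis by simp
    qed
    have flip: "qnorm_on (bits ?n) (\<lambda>x. apply_circuit B ?C ?\<phi> x - apply_circuit A' ?C ?\<phi> x) =
      qnorm_on (bits ?n) (\<lambda>x. apply_circuit A' ?C ?\<phi> x - apply_circuit B ?C ?\<phi> x)"
      by (simp add: norm_minus_commute)
    have dist: "qnorm_on (bits ?n) (\<lambda>x. apply_circuit A' ?C ?\<phi> x - apply_circuit A' ?C ?\<psi> x) =
      qnorm_on (bits ?n) ?d"
      using qnorm_apply_circuit[OF wf, of A' ?d] unfolding apply_circuit_diff .
    have "qnorm_on (bits ?n) (\<lambda>x. apply_circuit A ?C ?\<phi> x - apply_circuit A' ?C ?\<psi> x) \<le>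
      qnorm_on (bits ?n) (\<lambda>x. apply_circuit A ?C ?\<phi> x - apply_circuit B ?C ?\<phi> x) +
      qnorm_on (bits ?n) (\<lambda>x. apply_circuit B ?C ?\<phi> x - apply_circuit A' ?C ?\<psi> x)"
      by (rule qnorm_on_triangle)
    moreover have "qnorm_on (bits ?n) (\<lambda>x. apply_circuit B ?C ?\<phi> x - apply_circuit A' ?C ?\<psi> x) \<le>
      qnorm_on (bits ?n) (\<lambda>x. apply_circuit B ?C ?\<phi> x - apply_circuit A' ?C ?\<phi> x) +
      qnorm_on (bits ?n) (\<lambda>x. apply_circuit A' ?C ?\<phi> x - apply_circuit A' ?C ?\<psi> x)"
      by (rule qnorm_on_triangle)
    moreover have "qnorm_on (bits ?n) (\<lambda>x. apply_circuit A ?C ?\<phi> x - apply_circuit B ?C ?\<phi> x)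
      \<le> 2 * real (length ?C) * sqrt \<eta>"
      by (rule hyb[of w]) (use A in auto)
    moreover have "qnorm_on (bits ?n) (\<lambda>x. apply_circuit A' ?C ?\<phi> x - apply_circuit B ?C ?\<phi> x)
      \<le> 2 * real (length ?C) * sqrt \<eta>"
      by (rule hyb[of w']) (use A' in auto)
    ultimately have "qnorm_on (bits ?n) (\<lambda>x. apply_circuit A ?C ?\<phi> x - apply_circuit A' ?C ?\<psi> x) \<le>
      4 * real (length ?C) * sqrt \<eta> + (\<Sum>k<k. 4 * real (length (circuits V ! k)) * sqrt \<eta>)"
      using flip dist IH k by simp
    thus ?thesis using k by (simp add: add.commute)
  next
    case False
    then obtain k where k: "j = Suc (2 * k)" by (elim oddE) simp
    have "unitary_op (msg V + p) (P (j div 2))" using P unfolding is_prover_def by blast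
    from qnorm_apply_last[OF this, of "priv V" ?d]
    show ?thesis using False IH k by (simp add: add.assoc apply_last_diff)
  qed
qed

lemma accept_prob_hybrid:
  assumes V: "wf_verifier V" and P: "is_prover V p P"
    and A: "\<And>s. s \<noteq> w \<Longrightarrow> s \<in> A \<longleftrightarrow> s \<in> B" and A': "\<And>s. s \<noteq> w' \<Longrightarrow> s \<in> A' \<longleftrightarrow> s \<in> B"
    and weight: "\<And>k i u. k < length (circuits V) \<Longrightarrow> i < length (circuits V ! k) \<Longrightarrow> u = w \<or> u = w' \<Longrightarrow>
      query_weight (priv V + msg V + p) u (circuits V ! k ! i)
        (apply_circuit B (take i (circuits V ! k)) (joint_state A V p P (2 * k))) \<le> \<eta>"
    and N: "(\<Sum>C\<leftarrow>circuits V. length C) \<le> N" and "0 \<le> \<eta>"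
  shows "accept_prob A V p P \<le> accept_prob A' V p P + 8 * real N * sqrt \<eta>"
proof -
  let ?n = "priv V + msg V + p" and ?j = "Suc (num_messages V)"
  let ?d = "qnorm_on (bits ?n) (\<lambda>x. joint_state A V p P ?j x - joint_state A' V p P ?j x)"
  have half: "Suc ?j div 2 = length (circuits V)"
    using V unfolding wf_verifier_def num_messages_def by (cases "circuits V") auto
  have "?d \<le> (\<Sum>k<Suc ?j div 2. 4 * real (length (circuits V ! k)) * sqrt \<eta>)"
    by (rule interaction_hybrid[OF V P A A' weight]) auto
  also have "\<dots> = 4 * real (\<Sum>C\<leftarrow>circuits V. length C) * sqrt \<eta>"
    unfolding half by (simp add: sum_list_sum_nth atLeast0LessThan sum_distrib_left sum_distrib_right)
  also have "\<dots> \<le> 4 * real N * sqrt \<eta>"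
    using of_nat_mono[OF N, where ?'a = real] \<open>0 \<le> \<eta>\<close> by (intro mult_right_mono mult_left_mono) auto
  finally have d: "?d \<le> 4 * real N * sqrt \<eta>" .
  \<comment> \<open>Passing from distances to squared norms doubles the constant 4 to 8.\<close>
  have "accept_prob A V p P \<le> accept_prob A' V p P + 2 * ?d"
    unfolding accept_prob_def
    by (rule weight_diff_le) (use qnorm_joint_state[OF V P] in \<open>auto simp del: joint_state.simps\<close>)
  with d show ?thesis by simp
qed

lemma exists_light_string:
  fixes W :: "bool list \<Rightarrow> real"
  assumes "(\<Sum>u\<in>(#) b ` bits n. W u) \<le> M"
  shows "\<exists>w\<in>bits (Suc n). hd w = b \<and> W w \<le> M / 2 ^ n"
proof (rule ccontr)
  assume *: "\<not> ?thesis"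
  have card: "card ((#) b ` bits n) = 2 ^ n"
    by (subst card_image) (auto simp: card_bits)
  have "bits n \<noteq> {}" using card_bits[of n] by (metis card.empty power_not_zero zero_neq_numeral)
  have "(\<Sum>u\<in>(#) b ` bits n. M / 2 ^ n) < (\<Sum>u\<in>(#) b ` bits n. W u)"
  proof (rule sum_strict_mono)
    fix u assume "u \<in> (#) b ` bits n"
    hence "u \<in> bits (Suc n)" "hd u = b" by auto
    with * show "M / 2 ^ n < W u" by (meson not_le)
  qed (use \<open>bits n \<noteq> {}\<close> in auto)
  with assms card show False by simp
qed

text \<open>The clauses of \<open>QSZK\<close> at one input, with membership and error given as the
  values \<open>b\<close> and \<epsilon>. Only the circuits for this input occur, so a finite part
  of the oracle decides the outcome.\<close>

definition meets_conditions ::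
  "bool list set \<Rightarrow> verifier \<Rightarrow> simulator \<Rightarrow> real \<Rightarrow> bool \<Rightarrow> bool" where
  "meets_conditions A V S \<epsilon> b \<longleftrightarrow>
     (if b then \<exists>p P. is_prover V p P \<and> accept_prob A V p P \<ge> 2 / 3 \<and>
        (\<forall>j\<le>num_messages V. trace_distance (simulated_view A V (S ! j)) (view A V p P j) \<le> \<epsilon>)
      else \<forall>p P. is_prover V p P \<longrightarrow> accept_prob A V p P \<le> 1 / 3)"

text \<open>The threshold \<tau> is the average weight: at most \<open>2 * N\<close> in total,
  spread over the 2 ^ n strings with a prescribed first bit. A light string thus exists for each
  first bit, and the two inserted in turn require opposite behaviour of the verifier.\<close>

lemma conditions_violated:
  fixes N n :: nat and \<epsilon> :: real
  defines "\<tau> \<equiv> 2 * real N / 2 ^ n"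
  assumes V: "wf_verifier V" and S: "wf_simulator V S"
    and NV: "(\<Sum>C\<leftarrow>circuits V. length C) \<le> N" and NS: "(\<Sum>(s, C)\<leftarrow>S. length C) \<le> N"
    and "0 \<le> \<epsilon>" and small: "8 * real N * sqrt (\<tau> + 4 * real N * sqrt \<tau> + 2 * \<epsilon>) < 1 / 3"
  shows "\<exists>w\<in>bits (Suc n). \<not> meets_conditions (insert w B) V S \<epsilon> (hd w)"
proof (rule ccontr)
  assume "\<not> ?thesis"
  hence all: "meets_conditions (insert w B) V S \<epsilon> (hd w)" if "w \<in> bits (Suc n)" for w
    using that by blast
  let ?K = "priv V + msg V"
  define size where "size j = fst (S ! j)" for j
  define SC where "SC j = snd (S ! j)" for j
  define VC where "VC k = circuits V ! k" for k
  define sim where "sim A j = apply_circuit A (SC j) (zero_state (size j))" for A j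
  define sw where "sw u j i =
    query_weight (size j) u (SC j ! i) (apply_circuit B (take i (SC j)) (zero_state (size j)))" for u j i
  \<comment> \<open>The verifier's circuit is run on the simulated view instead of the true one.
    Index \<open>2 * k\<close> is the view just before this circuit; the simulator's further qubits
    stay untouched as ancillas.\<close>
  define vw where "vw u k i =
    query_weight (size (2 * k)) u (VC k ! i) (apply_circuit B (take i (VC k)) (sim B (2 * k)))" for u k i
  \<comment> \<open>One weight for both kinds of runs makes a single string light in the simulator's
    circuits and in the verifier's.\<close>
  define W where "W u = (\<Sum>j<length S. \<Sum>i<length (SC j). sw u j i) +
    (\<Sum>k<length (circuits V). \<Sum>i<length (VC k). vw u k i)" for u
  have wfS: "?K \<le> size j" "wf_circuit (size j) (SC j)" if "j < length S" for j
    using S that nth_mem[OF that] unfolding wf_simulator_def size_def SC_def by (auto simp: case_prod_beta)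
  have lenS: "2 * k < length S" if "k < length (circuits V)" for k
    using S that unfolding wf_simulator_def num_messages_def by simp
  have wfV: "wf_circuit ?K (VC k)" if "k < length (circuits V)" for k
    using wf_verifier_circuit[OF V that] unfolding VC_def .
  have sizeS: "(\<Sum>j<length S. real (length (SC j))) \<le> real N"
  proof -
    have "(\<Sum>(s, C)\<leftarrow>S. length C) = (\<Sum>j<length S. length (SC j))"
      by (simp add: sum_list_sum_nth atLeast0LessThan SC_def case_prod_beta)
    thus ?thesis using NS by (simp flip: of_nat_sum)
  qed
  have sizeV: "(\<Sum>k<length (circuits V). real (length (VC k))) \<le> real N"
  proof -
    have "(\<Sum>C\<leftarrow>circuits V. length C) = (\<Sum>k<length (circuits V). length (VC k))"
      by (simp add: sum_list_sum_nth atLeast0LessThan VC_def)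
    thus ?thesis using NV by (simp flip: of_nat_sum)
  qed
  have norm_sim: "qnorm_on (bits (size j)) (sim A j) = 1" if "j < length S" for A j
    unfolding sim_def using qnorm_apply_circuit[OF wfS(2)[OF that]] qnorm_zero_state by simp
  \<comment> \<open>Each gate spreads weight at most 1 over all strings, and there are at most
    \<open>N\<close> gates on either side.\<close>
  have total: "(\<Sum>u\<in>U. W u) \<le> 2 * real N" if U: "finite U" for U
  proof -
    have s: "(\<Sum>u\<in>U. sw u j i) \<le> 1" if "j < length S" for j i
      using sum_query_weight_le[OF U, of "size j" "SC j ! i"
          "apply_circuit B (take i (SC j)) (zero_state (size j))"]
        qnorm_apply_circuit[OF wf_circuit_take[OF wfS(2)[OF that]]] qnorm_zero_state
      unfolding sw_def by simp
    have v: "(\<Sum>u\<in>U. vw u k i) \<le> 1" if k: "k < length (circuits V)" for k i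
      using sum_query_weight_le[OF U, of "size (2 * k)" "VC k ! i"
          "apply_circuit B (take i (VC k)) (sim B (2 * k))"]
        qnorm_apply_circuit[OF wf_circuit_take[OF wf_circuit_mono[OF wfV[OF k] wfS(1)[OF lenS[OF k]]]]]
        norm_sim[OF lenS[OF k]]
      unfolding vw_def by simp
    have "(\<Sum>u\<in>U. W u) = (\<Sum>j<length S. \<Sum>i<length (SC j). \<Sum>u\<in>U. sw u j i) +
      (\<Sum>k<length (circuits V). \<Sum>i<length (VC k). \<Sum>u\<in>U. vw u k i)"
      unfolding W_def sum.distrib
      by (simp add: sum.swap[of _ _ U])
    also have "\<dots> \<le> (\<Sum>j<length S. \<Sum>i<length (SC j). 1) + (\<Sum>k<length (circuits V). \<Sum>i<length (VC k). 1)"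
      by (intro add_mono sum_mono s v) auto
    finally show ?thesis using sizeS sizeV by simp
  qed
  have sw0: "0 \<le> sw u j i" and vw0: "0 \<le> vw u k i" for u j k i
    unfolding sw_def vw_def by (rule query_weight_nonneg)+
  have sw_le: "sw u j i \<le> W u" if "j < length S" "i < length (SC j)" for u j i
  proof -
    have "sw u j i \<le> (\<Sum>i<length (SC j). sw u j i)"
      using that sw0 by (intro member_le_sum) auto
    also have "\<dots> \<le> (\<Sum>j<length S. \<Sum>i<length (SC j). sw u j i)"
      using that sw0 by (intro member_le_sum[of _ _ "\<lambda>j. \<Sum>i<length (SC j). sw u j i"] sum_nonneg) auto
    also have "\<dots> \<le> W u" unfolding W_def using vw0 by (simp add: sum_nonneg)
    finally show ?thesis .
  qed
  have vw_le: "vw u k i \<le> W u" if "k < length (circuits V)" "i < length (VC k)" for u k i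
  proof -
    have "vw u k i \<le> (\<Sum>i<length (VC k). vw u k i)"
      using that vw0 by (intro member_le_sum) auto
    also have "\<dots> \<le> (\<Sum>k<length (circuits V). \<Sum>i<length (VC k). vw u k i)"
      using that vw0 by (intro member_le_sum[of _ _ "\<lambda>k. \<Sum>i<length (VC k). vw u k i"] sum_nonneg) auto
    also have "\<dots> \<le> W u" unfolding W_def using sw0 by (simp add: sum_nonneg)
    finally show ?thesis .
  qed
  obtain w where w: "w \<in> bits (Suc n)" "hd w = True" "W w \<le> \<tau>"
    using exists_light_string[OF total, of True n] unfolding \<tau>_def by auto
  obtain w' where w': "w' \<in> bits (Suc n)" "hd w' = False" "W w' \<le> \<tau>"
    using exists_light_string[OF total, of False n] unfolding \<tau>_def by auto
  have \<tau>0: "0 \<le> \<tau>" unfolding \<tau>_def by simp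
  let ?A = "insert w B" and ?A' = "insert w' B"
  from all[OF w(1)] w(2) obtain p P where P: "is_prover V p P"
    and acc: "accept_prob ?A V p P \<ge> 2 / 3"
    and zk: "\<And>j. j \<le> num_messages V \<Longrightarrow>
      trace_distance (simulated_view ?A V (S ! j)) (view ?A V p P j) \<le> \<epsilon>"
    unfolding meets_conditions_def by auto
  \<comment> \<open>The summands are the weight under \<open>B\<close> on the simulated view, twice
    the distance \<open>2 * N * sqrt \<tau>\<close> between the simulated views for
    \<open>?A\<close> and \<open>B\<close>, and the trace norm between simulated and true
    view.\<close>
  define \<eta> where "\<eta> = \<tau> + 4 * real N * sqrt \<tau> + 2 * \<epsilon>"
  have \<eta>0: "0 \<le> \<eta>" unfolding \<eta>_def using \<tau>0 \<open>0 \<le> \<epsilon>\<close> by simp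
  have weight: "query_weight (?K + p) u (VC k ! i)
      (apply_circuit B (take i (VC k)) (joint_state ?A V p P (2 * k))) \<le> \<eta>"
    if k: "k < length (circuits V)" and i: "i < length (VC k)" and u: "u = w \<or> u = w'" for k i u
  proof -
    let ?j = "2 * k" and ?g = "VC k ! i" and ?C = "take i (VC k)"
    note jS = lenS[OF k]
    have wfC: "wf_circuit ?K ?C" using wf_circuit_take[OF wfV[OF k]] .
    have wfg: "wf_gate ?K ?g" using wfV[OF k] i unfolding wf_circuit_iff by simp
    obtain m where m: "size ?j = ?K + m" using wfS(1)[OF jS] by (metis le_iff_add)
    have wfC': "wf_circuit (size ?j) ?C" using wf_circuit_mono[OF wfC wfS(1)[OF jS]] .
    have "?j \<le> num_messages V" using k unfolding num_messages_def by simp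
    from zk[OF this] have tr: "trace_norm (reduced_state ?K (?K + m) (sim ?A ?j) -
        reduced_state ?K (?K + p) (joint_state ?A V p P ?j)) \<le> 2 * \<epsilon>"
      unfolding trace_distance_def view_def simulated_view_def
      by (simp add: case_prod_beta m[symmetric] sim_def size_def SC_def)
    have 1: "query_weight (?K + p) u ?g (apply_circuit B ?C (joint_state ?A V p P ?j)) \<le>
        query_weight (size ?j) u ?g (apply_circuit B ?C (sim ?A ?j)) + 2 * \<epsilon>"
      using query_weight_trace_norm[OF wfC wfg, of m u B "sim ?A ?j" p "joint_state ?A V p P ?j"] tr
      unfolding m by linarith
    have "qnorm_on (bits (size ?j)) (\<lambda>x. sim ?A ?j x - sim B ?j x) \<le>
        (\<Sum>i<length (SC ?j). 2 * sqrt (sw w ?j i))"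
      unfolding sim_def sw_def by (rule circuit_hybrid[OF wfS(2)[OF jS]]) auto
    also have "\<dots> \<le> (\<Sum>i<length (SC ?j). 2 * sqrt \<tau>)"
      using sw_le[OF jS] w(3) by (intro sum_mono mult_left_mono real_sqrt_le_mono) (auto intro: order_trans)
    also have "\<dots> = 2 * real (length (SC ?j)) * sqrt \<tau>" by simp
    also have "\<dots> \<le> 2 * real N * sqrt \<tau>"
    proof -
      have "real (length (SC ?j)) \<le> (\<Sum>j<length S. real (length (SC j)))"
        using jS by (intro member_le_sum[of _ _ "\<lambda>j. real (length (SC j))"]) auto
      hence "real (length (SC ?j)) \<le> real N" using sizeS by linarith
      thus ?thesis using \<tau>0 by (intro mult_right_mono) auto
    qed
    finally have sd: "qnorm_on (bits (size ?j)) (\<lambda>x. sim ?A ?j x - sim B ?j x) \<le> 2 * real N * sqrt \<tau>" .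
    have "query_weight (size ?j) u ?g (apply_circuit B ?C (sim ?A ?j)) \<le>
        query_weight (size ?j) u ?g (apply_circuit B ?C (sim B ?j)) +
        2 * qnorm_on (bits (size ?j)) (\<lambda>x. apply_circuit B ?C (sim ?A ?j) x - apply_circuit B ?C (sim B ?j) x)"
      unfolding query_weight_def
      by (rule weight_diff_le) (use qnorm_apply_circuit[OF wfC'] norm_sim[OF jS] in auto)
    also have "qnorm_on (bits (size ?j)) (\<lambda>x. apply_circuit B ?C (sim ?A ?j) x - apply_circuit B ?C (sim B ?j) x) =
        qnorm_on (bits (size ?j)) (\<lambda>x. sim ?A ?j x - sim B ?j x)"
      using qnorm_apply_circuit[OF wfC', of B "\<lambda>x. sim ?A ?j x - sim B ?j x"] unfolding apply_circuit_diff .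
    finally have 2: "query_weight (size ?j) u ?g (apply_circuit B ?C (sim ?A ?j)) \<le> vw u k i + 4 * real N * sqrt \<tau>"
      using sd unfolding vw_def by simp
    have "vw u k i \<le> \<tau>" using vw_le[OF k i, of u] u w(3) w'(3) by auto
    with 1 2 show ?thesis unfolding \<eta>_def by linarith
  qed
  \<comment> \<open>The honest prover for \<open>w\<close> is played against the verifier whose oracle marks \<open>w'\<close> instead.\<close>
  have "accept_prob ?A V p P \<le> accept_prob ?A' V p P + 8 * real N * sqrt \<eta>"
  proof (rule accept_prob_hybrid[OF V P _ _ _ NV \<eta>0])
    fix k i u assume "k < length (circuits V)" "i < length (circuits V ! k)" "u = w \<or> u = w'"
    thus "query_weight (?K + p) u (circuits V ! k ! i)
      (apply_circuit B (take i (circuits V ! k)) (joint_state ?A V p P (2 * k))) \<le> \<eta>"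
      using weight[of k i u] unfolding VC_def by simp
  qed auto
  moreover have "accept_prob ?A' V p P \<le> 1 / 3"
    using all[OF w'(1)] w'(2) P unfolding meets_conditions_def by auto
  ultimately show False using acc small unfolding \<eta>_def by linarith
qed

text \<open>It is the m-th power of n / x ^ n, where x > 1 is the m-th root of 2.\<close>

lemma power_over_exponential_tendsto_0:
  assumes "0 < m"
  shows "(\<lambda>n. real n ^ m / 2 ^ n) \<longlonglongrightarrow> 0"
proof -
  define x where "x = root m (2 :: real)"
  have "x > 1" "x ^ m = 2" using assms unfolding x_def by auto
  hence "(\<lambda>n. real n / x ^ n) \<longlonglongrightarrow> 0" using lim_n_over_pown[of x] by simp
  hence "(\<lambda>n. (real n / x ^ n) ^ m) \<longlonglongrightarrow> 0 ^ m" by (rule tendsto_power)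
  moreover have "(real n / x ^ n) ^ m = real n ^ m / 2 ^ n" for n
    unfolding power_divide power_mult[symmetric] mult.commute[of n m] power_mult \<open>x ^ m = 2\<close> ..
  ultimately show ?thesis using assms by (simp add: power_0_left)
qed

text \<open>The exponent is one more than the degree, so that it is positive even for
  constants.\<close>

lemma poly_le_monomial:
  fixes p :: "nat poly"
  shows "\<exists>a d :: nat. 0 < d \<and> (\<forall>n\<ge>1. poly p n \<le> a * n ^ d)"
proof (intro exI conjI allI impI)
  show "0 < Suc (degree p)" by simp
  fix n :: nat assume n: "1 \<le> n"
  have "poly p n = (\<Sum>i\<le>degree p. coeff p i * n ^ i)" by (rule poly_altdef)
  also have "\<dots> \<le> (\<Sum>i\<le>degree p. coeff p i * n ^ Suc (degree p))"
    using n by (intro sum_mono mult_left_mono power_increasing) auto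
  finally show "poly p n \<le> (\<Sum>i\<le>degree p. coeff p i) * n ^ Suc (degree p)"
    by (simp add: sum_distrib_right)
qed

text \<open>After squaring, the error term is multiplied by the square of the polynomial, of order n
  ^ (2 * d); the exponent 2 * d + 1 leaves 1 / n.\<close>

lemma polynomial_gap_vanishes:
  fixes p :: "nat poly"
  shows "\<exists>c. \<forall>\<^sub>F n in sequentially.
    8 * real (poly p n) * sqrt (2 * real (poly p n) / 2 ^ n +
      4 * real (poly p n) * sqrt (2 * real (poly p n) / 2 ^ n) + 2 * (1 / real n ^ c)) < 1 / 3"
proof -
  obtain a0 d where d: "0 < d" and pa: "\<And>n. 1 \<le> n \<Longrightarrow> poly p n \<le> a0 * n ^ d"
    using poly_le_monomial[of p] by blast
  define a where "a = real a0"
  have a0: "0 \<le> a" unfolding a_def by simp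
  \<comment> \<open>The square of the left-hand side with the polynomial replaced by a * n ^ d; 64
    is the square of 8. In the middle term, n ^ (3 * d) is drawn under the root, where it meets n ^
    d.\<close>
  define H where "H n = 128 * a ^ 3 * (real n ^ (3 * d) / 2 ^ n) +
    256 * a ^ 3 * sqrt (2 * a * (real n ^ (7 * d) / 2 ^ n)) + 128 * a\<^sup>2 * (1 / real n)" for n
  have "H \<longlonglongrightarrow> 128 * a ^ 3 * 0 + 256 * a ^ 3 * sqrt (2 * a * 0) + 128 * a\<^sup>2 * 0"
    unfolding H_def using d
    by (intro tendsto_intros power_over_exponential_tendsto_0 lim_1_over_n) auto
  hence "\<forall>\<^sub>F n in sequentially. H n < 1 / 9" by (intro order_tendstoD(2)[of H 0]) auto
  moreover have "\<forall>\<^sub>F n :: nat in sequentially. 1 \<le> n" by (rule eventually_ge_at_top)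
  ultimately have "\<forall>\<^sub>F n in sequentially.
    8 * real (poly p n) * sqrt (2 * real (poly p n) / 2 ^ n +
      4 * real (poly p n) * sqrt (2 * real (poly p n) / 2 ^ n) + 2 * (1 / real n ^ (2 * d + 1))) < 1 / 3"
  proof eventually_elim
    case (elim n)
    define N where "N = real (poly p n)"
    define F where "F = a * real n ^ d"
    let ?e = "2 * (1 / real n ^ (2 * d + 1))"
    have N: "0 \<le> N" "N \<le> F"
      using of_nat_mono[OF pa[OF elim(2)], where ?'a = real] unfolding N_def F_def a_def by simp_all
    have F0: "0 \<le> F" using N by simp
    have n0: "real n > 0" using elim(2) by simp
    have "8 * N * sqrt (2 * N / 2 ^ n + 4 * N * sqrt (2 * N / 2 ^ n) + ?e) \<le>
      8 * F * sqrt (2 * F / 2 ^ n + 4 * F * sqrt (2 * F / 2 ^ n) + ?e)"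
      using N F0 by (intro mult_mono real_sqrt_le_mono add_mono order_refl divide_right_mono) auto
    also have "\<dots> < 1 / 3"
    proof (rule power2_less_imp_less)
      have gen: "x * sqrt y = sqrt (x\<^sup>2 * y)" if "0 \<le> x" for x y :: real
        using that by (simp add: real_sqrt_mult)
      have e1: "64 * F\<^sup>2 * (2 * F / 2 ^ n) = 128 * a ^ 3 * (real n ^ (3 * d) / 2 ^ n)"
        unfolding F_def by (simp add: power_mult_distrib power2_eq_square power3_eq_cube power_mult
            mult_ac power_commutes)
      have "64 * F\<^sup>2 * (4 * F * sqrt (2 * F / 2 ^ n)) = 256 * a ^ 3 * (real n ^ (3 * d) * sqrt (2 * F / 2 ^ n))"
        unfolding F_def by (simp add: power_mult_distrib power2_eq_square power3_eq_cube power_mult mult_ac)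
      also have "real n ^ (3 * d) * sqrt (2 * F / 2 ^ n) = sqrt ((real n ^ (3 * d))\<^sup>2 * (2 * F / 2 ^ n))"
        by (rule gen) simp
      also have "(real n ^ (3 * d))\<^sup>2 * (2 * F / 2 ^ n) = 2 * a * (real n ^ (7 * d) / 2 ^ n)"
      proof -
        have "(real n ^ (3 * d))\<^sup>2 * real n ^ d = real n ^ (3 * d * 2 + d)"
          by (simp only: power_add power_mult)
        also have "3 * d * 2 + d = 7 * d" by simp
        finally show ?thesis unfolding F_def by (simp add: mult_ac)
      qed
      finally have e2: "64 * F\<^sup>2 * (4 * F * sqrt (2 * F / 2 ^ n)) =
        256 * a ^ 3 * sqrt (2 * a * (real n ^ (7 * d) / 2 ^ n))" .
      have e3: "64 * F\<^sup>2 * ?e = 128 * a\<^sup>2 * (1 / real n)"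
        unfolding F_def using n0
        by (simp add: power_mult_distrib power_add power_mult field_simps)
      have "(8 * F * sqrt (2 * F / 2 ^ n + 4 * F * sqrt (2 * F / 2 ^ n) + ?e))\<^sup>2 =
        64 * F\<^sup>2 * (2 * F / 2 ^ n + 4 * F * sqrt (2 * F / 2 ^ n) + ?e)"
        using F0 by (simp add: power_mult_distrib)
      also have "\<dots> = H n" unfolding H_def distrib_left e1 e2 e3 ..
      also have "\<dots> < (1 / 3)\<^sup>2" using elim(1) by (simp add: power2_eq_square)
      finally show "(8 * F * sqrt (2 * F / 2 ^ n + 4 * F * sqrt (2 * F / 2 ^ n) + ?e))\<^sup>2 < (1 / 3)\<^sup>2" .
    qed simp
    finally show ?case unfolding N_def .
  qed
  thus ?thesis by blast
qed

subsection \<open>Diagonalization\<close>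

definition agree_upto :: "nat \<Rightarrow> bool list set \<Rightarrow> bool list set \<Rightarrow> bool" where
  "agree_upto m A B \<longleftrightarrow> (\<forall>s. length s \<le> m \<longrightarrow> (s \<in> A \<longleftrightarrow> s \<in> B))"

text \<open>Bounding the width of gates bounds the lengths of the queried strings, beyond which the
  oracle is invisible.\<close>

definition narrow :: "nat \<Rightarrow> circuit \<Rightarrow> bool" where
  "narrow m C \<longleftrightarrow> (\<forall>g\<in>set C. length (gate_qubits g) \<le> m)"

lemma apply_circuit_agree:
  assumes "agree_upto m A B" "narrow m C"
  shows "apply_circuit A C = apply_circuit B C"
proof -
  have gate: "apply_gate A g = apply_gate B g" if "g \<in> set C" for g
  proof (cases g)
    case (Query qs t)
    hence "length qs \<le> m" using assms(2) that unfolding narrow_def by fastforce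
    hence "map ((!) x) qs \<in> A \<longleftrightarrow> map ((!) x) qs \<in> B" for x
      using assms(1) unfolding agree_upto_def by simp
    thus ?thesis unfolding Query by (intro ext) simp
  qed (auto intro!: ext)
  have "apply_circuit A C \<psi> = apply_circuit B C \<psi>" for \<psi>
    unfolding apply_circuit_def by (rule List.fold_cong[OF refl refl gate])
  thus ?thesis by (rule ext)
qed

lemma narrow_nth: "\<forall>C\<in>set Cs. narrow m C \<Longrightarrow> i < length Cs \<Longrightarrow> narrow m (Cs ! i)"
  by simp

lemma joint_state_agree:
  assumes "agree_upto m A B" "\<forall>C\<in>set (circuits V). narrow m C" "wf_verifier V"
    "j \<le> Suc (num_messages V)"
  shows "joint_state A V p P j = joint_state B V p P j"
  using assms(4)
proof (induction j)
  case (Suc j)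
  have "narrow m (circuits V ! (j div 2))"
    using Suc.prems num_messages_div_less[OF assms(3), of j] assms(2) by (intro narrow_nth) auto
  from apply_circuit_agree[OF assms(1) this] Suc show ?case by simp
qed simp

lemma meets_conditions_agree:
  assumes "agree_upto m A B" "\<forall>C\<in>set (circuits V). narrow m C" "\<forall>C\<in>snd ` set S. narrow m C"
    and V: "wf_verifier V" and S: "wf_simulator V S"
  shows "meets_conditions A V S \<epsilon> b = meets_conditions B V S \<epsilon> b"
proof -
  note js = joint_state_agree[OF assms(1,2) V]
  have acc: "accept_prob A V p P = accept_prob B V p P" for p P
    unfolding accept_prob_def using js[OF order_refl] by (simp only:)
  have view: "view A V p P j = view B V p P j" if "j \<le> num_messages V" for p P j
    unfolding view_def using js[of j] that by simp
  have sim: "simulated_view A V (S ! j) = simulated_view B V (S ! j)" if "j \<le> num_messages V" for j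
  proof -
    have "S ! j \<in> set S" using S that unfolding wf_simulator_def by simp
    hence "narrow m (snd (S ! j))" using assms(3) by blast
    from apply_circuit_agree[OF assms(1) this] show ?thesis
      unfolding simulated_view_def by (simp add: case_prod_beta)
  qed
  show ?thesis unfolding meets_conditions_def using acc view sim by simp
qed

lemma narrow_mono: "narrow m C \<Longrightarrow> m \<le> m' \<Longrightarrow> narrow m' C"
  unfolding narrow_def by auto

lemma finite_circuits_narrow:
  assumes "finite F"
  shows "\<exists>m. \<forall>C\<in>F. narrow m C"
  using assms
proof (induction F)
  case (insert C F)
  then obtain m where m: "\<forall>C\<in>F. narrow m C" by blast
  have "narrow (\<Sum>g\<leftarrow>C. length (gate_qubits g)) C"
    unfolding narrow_def by (auto intro!: member_le_sum_list)
  hence "\<forall>C'\<in>insert C F. narrow (m + (\<Sum>g\<leftarrow>C. length (gate_qubits g))) C'"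
    using m narrow_mono by (metis insert_iff le_add1 le_add2)
  thus ?case by blast
qed simp

section \<open>Category argument on the space of markings\<close>

definition marking :: "(nat \<Rightarrow> bool list) \<Rightarrow> bool" where
  "marking g \<longleftrightarrow> (\<forall>n. length (g n) = Suc n)"

text \<open>With finite prefixes of markings as basic open sets, this says that \<open>D\<close>
  contains a dense open set.\<close>

definition determined_densely :: "((nat \<Rightarrow> bool list) \<Rightarrow> bool) \<Rightarrow> bool" where
  "determined_densely D \<longleftrightarrow> (\<forall>g M. marking g \<longrightarrow> (\<exists>g' M'. marking g' \<and> (\<forall>i<M. g' i = g i) \<and>
     (\<forall>h. marking h \<and> (\<forall>i<M'. h i = g' i) \<longrightarrow> D h)))"

text \<open>The Baire category theorem for the space of markings.\<close>

lemma generic_marking: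
  assumes "countable \<D>" "\<And>D. D \<in> \<D> \<Longrightarrow> determined_densely D"
  obtains h where "marking h" "\<And>D. D \<in> \<D> \<Longrightarrow> D h"
proof -
  \<comment> \<open>The trivial condition makes the family nonempty, so that it can be
    enumerated.\<close>
  define \<D>' where "\<D>' = insert (\<lambda>_. True) \<D>"
  have "\<exists>g' M'. marking g' \<and> (\<forall>i<M. g' i = g i) \<and>
     (\<forall>h. marking h \<and> (\<forall>i<M'. h i = g' i) \<longrightarrow> True)" if "marking g" for g and M :: nat
    using that by blast
  hence "determined_densely (\<lambda>_. True)" unfolding determined_densely_def by blast
  hence dense: "determined_densely D" if "D \<in> \<D>'" for D
    using that assms(2) unfolding \<D>'_def by blast
  have cnt: "countable \<D>'" "\<D>' \<noteq> {}" using assms(1) unfolding \<D>'_def by auto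
  define D where "D k = from_nat_into \<D>' k" for k
  have D: "D k \<in> \<D>'" for k unfolding D_def using cnt(2) by (rule from_nat_into)
  define Q where "Q k s s' \<longleftrightarrow> snd s < snd s' \<and> (\<forall>i<snd s. fst s' i = fst s i) \<and>
    (\<forall>h. marking h \<and> (\<forall>i<snd s'. h i = fst s' i) \<longrightarrow> D k h)"
    for k :: nat and s s' :: "(nat \<Rightarrow> bool list) \<times> nat"
  have "\<exists>f. \<forall>k. marking (fst (f k)) \<and> Q k (f k) (f (Suc k))"
  proof (rule dependent_nat_choice)
    show "\<exists>s :: (nat \<Rightarrow> bool list) \<times> nat. marking (fst s)"
      by (intro exI[of _ "(\<lambda>n. replicate (Suc n) False, 0)"]) (simp add: marking_def)
  next
    fix s :: "(nat \<Rightarrow> bool list) \<times> nat" and k :: nat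
    assume "marking (fst s)"
    with dense[OF D[of k]] obtain g' M' where g': "marking g'" "\<forall>i<snd s. g' i = fst s i"
      "\<forall>h. marking h \<and> (\<forall>i<M'. h i = g' i) \<longrightarrow> D k h"
      unfolding determined_densely_def by blast
    show "\<exists>s'. marking (fst s') \<and> Q k s s'"
      \<comment> \<open>The maximum makes the fixed prefix grow strictly, so that the limit is
        defined at every index.\<close>
      by (rule exI[of _ "(g', max M' (Suc (snd s)))"]) (use g' in \<open>auto simp: Q_def\<close>)
  qed
  then obtain f where f: "\<And>k. marking (fst (f k))" "\<And>k. Q k (f k) (f (Suc k))" by blast
  define g where "g k = fst (f k)" for k
  define M where "M k = snd (f k)" for k
  have step: "M k < M (Suc k)" "\<forall>i<M k. g (Suc k) i = g k i"
    "\<And>h. marking h \<Longrightarrow> \<forall>i<M (Suc k). h i = g (Suc k) i \<Longrightarrow> D k h" for k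
    using f(2)[of k] unfolding Q_def g_def M_def by auto
  have M_mono: "M k \<le> M l" if "k \<le> l" for k l
    using that by (induction l rule: dec_induct) (use step(1) less_imp_le order_trans in blast)+
  have M_ge: "k \<le> M k" for k
    by (induction k) (use step(1) in \<open>auto simp: Suc_le_eq intro: le_less_trans\<close>)
  have agree: "g l i = g k i" if "k \<le> l" "i < M k" for k l i
    using that(1)
  proof (induction l rule: dec_induct)
    case (step l)
    have "i < M l" using M_mono[OF step.hyps(1)] that(2) by simp
    thus ?case using \<open>\<And>k. \<forall>i<M k. g (Suc k) i = g k i\<close> step.IH by simp
  qed simp
  \<comment> \<open>Stage \<open>Suc i\<close> has fixed at least the indices up to
    \<open>i\<close>.\<close>
  define h where "h i = g (Suc i) i" for i
  have h_agree: "h i = g k i" if "i < M k" for i k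
  proof (cases "Suc i \<le> k")
    case True
    thus ?thesis unfolding h_def using agree[OF True] M_ge[of "Suc i"] by simp
  next
    case False
    thus ?thesis unfolding h_def using agree[of k "Suc i" i] that by simp
  qed
  have "marking h" using f(1) unfolding marking_def h_def g_def by simp
  moreover have "E h" if "E \<in> \<D>" for E
  proof -
    have "E \<in> \<D>'" using that unfolding \<D>'_def by simp
    then obtain k where "D k = E" unfolding D_def using from_nat_into_surj[OF cnt(1)] by blast
    moreover have "D k h" using step(3)[OF \<open>marking h\<close>, of k] h_agree by blast
    ultimately show ?thesis by simp
  qed
  ultimately show thesis by (rule that)
qed

definition uniform_system :: "(bool list \<Rightarrow> verifier) \<Rightarrow> (bool list \<Rightarrow> simulator) \<Rightarrow> bool" where
  "uniform_system V S \<longleftrightarrow> poly_time_computable (\<lambda>x. enc_verifier (V x)) \<and>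
     poly_time_computable (\<lambda>x. enc_simulator (S x)) \<and>
     (\<forall>x. wf_verifier (V x) \<and> wf_simulator (V x) (S x))"

text \<open>A negligible error is below 1 / n ^ c only for long inputs, so violations are wanted
  beyond every \<open>N\<close>. The last argument is membership of \<open>x\<close> in
  \<open>marked_lang h True\<close>.\<close>

definition violated_beyond ::
  "(bool list \<Rightarrow> verifier) \<Rightarrow> (bool list \<Rightarrow> simulator) \<Rightarrow> nat \<Rightarrow> nat \<Rightarrow> (nat \<Rightarrow> bool list) \<Rightarrow> bool" where
  "violated_beyond V S c N h \<longleftrightarrow> (\<exists>x. N \<le> length x \<and>
     \<not> meets_conditions (range h) (V x) (S x) (1 / real (length x) ^ c) (hd (h (length x))))"

text \<open>Changing \<open>g\<close> at one late index \<open>n\<close> to a suitable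
  \<open>w\<close> violates the conditions at an input of length \<open>n\<close>. The finitely many
  circuits for this input see only strings of bounded length, so a finite prefix of the marking
  preserves the violation.\<close>

lemma violated_densely:
  assumes "uniform_system V S"
  shows "\<exists>c. \<forall>N. determined_densely (violated_beyond V S c N)"
proof -
  have wf: "wf_verifier (V x)" "wf_simulator (V x) (S x)" for x
    using assms unfolding uniform_system_def by auto
  obtain p where p: "\<And>x. length (enc_verifier (V x)) \<le> poly p (length x)"
    using assms poly_time_computable_length unfolding uniform_system_def by blast
  obtain q where q: "\<And>x. length (enc_simulator (S x)) \<le> poly q (length x)"
    using assms poly_time_computable_length unfolding uniform_system_def by blast
  obtain c where c: "\<forall>\<^sub>F n in sequentially.
    8 * real (poly (p + q) n) * sqrt (2 * real (poly (p + q) n) / 2 ^ n +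
      4 * real (poly (p + q) n) * sqrt (2 * real (poly (p + q) n) / 2 ^ n) + 2 * (1 / real n ^ c)) < 1 / 3"
    using polynomial_gap_vanishes by blast
  have "determined_densely (violated_beyond V S c N)" for N
    unfolding determined_densely_def
  proof (intro allI impI)
    fix g M assume g: "marking g"
    obtain n where n: "N \<le> n" "M \<le> n"
      and small: "8 * real (poly (p + q) n) * sqrt (2 * real (poly (p + q) n) / 2 ^ n +
        4 * real (poly (p + q) n) * sqrt (2 * real (poly (p + q) n) / 2 ^ n) + 2 * (1 / real n ^ c)) < 1 / 3"
      using eventually_happens'[OF sequentially_bot eventually_conj[OF c
          eventually_conj[OF eventually_ge_at_top[of N] eventually_ge_at_top[of M]]]] by blast
    let ?x = "replicate n True"
    let ?V = "V ?x" and ?S = "S ?x" and ?B = "g ` (- {n})"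
    have NV: "(\<Sum>C\<leftarrow>circuits ?V. length C) \<le> poly (p + q) n"
      using gate_count_le_enc_verifier[of ?V] p[of ?x] by simp
    have NS: "(\<Sum>(s, C)\<leftarrow>?S. length C) \<le> poly (p + q) n"
      using gate_count_le_enc_simulator[of ?S] q[of ?x] by simp
    obtain w where w: "w \<in> bits (Suc n)" "\<not> meets_conditions (insert w ?B) ?V ?S (1 / real n ^ c) (hd w)"
      using conditions_violated[OF wf NV NS _ small, of ?B] by auto
    obtain m where m: "\<forall>C\<in>set (circuits ?V) \<union> snd ` set ?S. narrow m C"
      using finite_circuits_narrow[of "set (circuits ?V) \<union> snd ` set ?S"] by auto
    define g' where "g' = g(n := w)"
    have g': "marking g'" using g w(1) unfolding marking_def g'_def by simp
    have range: "range g' = insert w ?B" unfolding g'_def by (auto simp: image_iff)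
    \<comment> \<open>The bound \<open>Suc n\<close> fixes \<open>h n = w\<close>; the bound
      \<open>m\<close> fixes all marked strings of length at most \<open>m\<close>, as the string at
      index \<open>i\<close> has length i + 1.\<close>
    have "violated_beyond V S c N h" if h: "marking h" "\<forall>i<max m (Suc n). h i = g' i" for h
    proof -
      have sub: "s \<in> range f'" if s: "s \<in> range f" "length s \<le> m" and f: "marking f"
        and ff': "\<forall>i<max m (Suc n). f i = f' i" for s f f'
      proof -
        obtain i where i: "s = f i" using s by blast
        hence "i < m" using s f unfolding marking_def by (metis Suc_le_lessD)
        thus ?thesis using i ff' by simp
      qed
      have "agree_upto m (range h) (range g')"
        unfolding agree_upto_def using sub[OF _ _ h(1)] sub[OF _ _ g'] h(2) by metis
      from meets_conditions_agree[OF this _ _ wf] m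
      have "meets_conditions (range h) ?V ?S (1 / real n ^ c) (hd w) =
        meets_conditions (range g') ?V ?S (1 / real n ^ c) (hd w)" by blast
      moreover have "h n = w" using h(2) unfolding g'_def by simp
      ultimately show ?thesis
        unfolding violated_beyond_def using n(1) w(2) range
        by (intro exI[of _ ?x]) simp
    qed
    thus "\<exists>g' M'. marking g' \<and> (\<forall>i<M. g' i = g i) \<and>
      (\<forall>h. marking h \<and> (\<forall>i<M'. h i = g' i) \<longrightarrow> violated_beyond V S c N h)"
      using g' n(2) unfolding g'_def
      by (intro exI[of _ "g(n := w)"] exI[of _ "max m (Suc n)"]) auto
  qed
  thus ?thesis by blast
qed

text \<open>Injective encodings embed the systems into pairs of computable functions.\<close>

lemma countable_uniform_systems: "countable {(V, S). uniform_system V S}"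
proof -
  let ?e = "\<lambda>(V :: bool list \<Rightarrow> verifier, S :: bool list \<Rightarrow> simulator). (enc_verifier \<circ> V, enc_simulator \<circ> S)"
  have inj: "inj ?e"
  proof (rule injI)
    fix X Y assume *: "?e X = ?e Y"
    obtain V S W T where XY: "X = (V, S)" "Y = (W, T)" by (metis surj_pair)
    have "V x = W x" "S x = T x" for x
    proof -
      have e: "enc_verifier (V x) = enc_verifier (W x)" "enc_simulator (S x) = enc_simulator (T x)"
        using * unfolding XY by (auto simp: fun_eq_iff)
      show "V x = W x" by (rule injD[OF inj_enc_verifier e(1)])
      show "S x = T x" by (rule injD[OF inj_enc_simulator e(2)])
    qed
    thus "X = Y" unfolding XY by (simp add: fun_eq_iff)
  qed
  have "?e ` {(V, S). uniform_system V S} \<subseteq>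
      {f. poly_time_computable f} \<times> {f. poly_time_computable f}"
    by (auto simp: uniform_system_def comp_def)
  hence "countable (?e ` {(V, S). uniform_system V S})"
    by (rule countable_subset)
      (intro countable_SIGMA countable_poly_time_computable)
  thus ?thesis by (rule countable_image_inj_on) (rule inj_on_subset[OF inj subset_UNIV])
qed

text \<open>Negligible functions are uncountable in number. Replacing \<epsilon> by the bounds 1 / n
  ^ c, valid from some length on, leaves countably many conditions to defeat.\<close>

lemma QSZK_meets_conditions:
  assumes "L \<in> QSZK A"
  obtains V S where "uniform_system V S"
    "\<And>c. \<exists>N. \<forall>x. N \<le> length x \<longrightarrow> meets_conditions A (V x) (S x) (1 / real (length x) ^ c) (x \<in> L)"
proof -
  obtain V :: "bool list \<Rightarrow> verifier" and S :: "bool list \<Rightarrow> simulator" and \<epsilon>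
    where comp: "poly_time_computable (\<lambda>x. enc_verifier (V x))"
      "poly_time_computable (\<lambda>x. enc_simulator (S x))"
    and neg: "negligible_fun \<epsilon>"
    and wf: "\<forall>x. wf_verifier (V x) \<and> wf_simulator (V x) (S x)"
    and yes: "\<forall>x\<in>L. \<exists>p P. is_prover (V x) p P \<and> accept_prob A (V x) p P \<ge> 2 / 3 \<and>
        (\<forall>j\<le>num_messages (V x).
           trace_distance (simulated_view A (V x) (S x ! j)) (view A (V x) p P j) \<le> \<epsilon> (length x))"
    and no: "\<forall>x. x \<notin> L \<longrightarrow> (\<forall>p P. is_prover (V x) p P \<longrightarrow> accept_prob A (V x) p P \<le> 1 / 3)"
    using assms unfolding QSZK_def by blast
  have "\<exists>N. \<forall>x. N \<le> length x \<longrightarrow> meets_conditions A (V x) (S x) (1 / real (length x) ^ c) (x \<in> L)" for c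
  proof -
    obtain N where N: "\<And>n. N \<le> n \<Longrightarrow> \<bar>\<epsilon> n\<bar> < 1 / real n ^ c"
      using neg unfolding negligible_fun_def eventually_sequentially by blast
    have "meets_conditions A (V x) (S x) (1 / real (length x) ^ c) (x \<in> L)" if "N \<le> length x" for x
    proof (cases "x \<in> L")
      case True
      have le: "\<epsilon> (length x) \<le> 1 / real (length x) ^ c" using N[OF that] by simp
      obtain p P where "is_prover (V x) p P" "accept_prob A (V x) p P \<ge> 2 / 3"
        "\<forall>j\<le>num_messages (V x).
           trace_distance (simulated_view A (V x) (S x ! j)) (view A (V x) p P j) \<le> \<epsilon> (length x)"
        using yes True by blast
      thus ?thesis unfolding meets_conditions_def using True le by (auto intro: order_trans)
    next
      case False
      thus ?thesis unfolding meets_conditions_def using no by simp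
    qed
    thus ?thesis by blast
  qed
  moreover have "uniform_system V S" unfolding uniform_system_def using comp wf by blast
  ultimately show thesis by (rule that[rotated])
qed

theorem theorem4:
  shows "\<exists>A :: bool list set. \<not> (UP A \<inter> coUP A \<subseteq> QSZK A)"
proof -
  \<comment> \<open>The exponent depends on the size of the circuits, so it is chosen for each
    system separately.\<close>
  obtain c where c: "\<And>V S N. uniform_system V S \<Longrightarrow> determined_densely (violated_beyond V S (c V S) N)"
    using violated_densely by metis
  let ?D = "\<lambda>((V, S), N). violated_beyond V S (c V S) N"
  have "countable (?D ` ({(V, S). uniform_system V S} \<times> UNIV))"
    using countable_uniform_systems by (intro countable_image countable_SIGMA) auto
  then obtain h where h: "marking h"
    and viol: "\<And>D. D \<in> ?D ` ({(V, S). uniform_system V S} \<times> UNIV) \<Longrightarrow> D h"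
    by (rule generic_marking) (use c in auto)
  have len: "length (h n) = Suc n" for n using h unfolding marking_def by blast
  have "marked_lang h True \<in> UP (range h) \<inter> coUP (range h)"
    using marked_lang_in_UP[of h] marked_lang_in_coUP[of h] len by blast
  moreover have "marked_lang h True \<notin> QSZK (range h)"
  proof
    assume "marked_lang h True \<in> QSZK (range h)"
    then obtain V S where VS: "uniform_system V S"
      and good: "\<And>c. \<exists>N. \<forall>x. N \<le> length x \<longrightarrow>
        meets_conditions (range h) (V x) (S x) (1 / real (length x) ^ c) (x \<in> marked_lang h True)"
      by (rule QSZK_meets_conditions) blast
    obtain N where N: "\<forall>x. N \<le> length x \<longrightarrow>
        meets_conditions (range h) (V x) (S x) (1 / real (length x) ^ c V S) (x \<in> marked_lang h True)"
      using good[of "c V S"] by blast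
    have "violated_beyond V S (c V S) N h"
      using viol[of "violated_beyond V S (c V S) N"] VS by (auto simp: image_iff)
    with N show False unfolding violated_beyond_def marked_lang_def by auto
  qed
  ultimately show ?thesis by blast
qed

end
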